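(* Let $\varphi$ be a positive linear map on a unital $C^*$-algebra $\mathcal{A}$ with $r=r(\varphi)$. The following are equivalent: (1) there is a positive map $\psi$ on $\mathcal{A}$ elementarily similar to $\varphi$ with $\|\psi\|=r$; (2) there exists a strictly positive $w\in\mathcal{A}$ with $\varphi(w)\le r\,w$; (3) there exists a strictly positive $v\in\mathcal{A}$ with $\|\alpha_v^{-1}\circ\varphi\circ\alpha_v\|=r$.
   Context: $r(\varphi)$ is the spectral radius of $\varphi$ as a bounded operator on $\mathcal{A}$; $\|\cdot\|$ is the operator norm. Strictly positive means positive and invertible. For $a\in\mathcal{A}$, $\alpha_a(x)=a^*xa$; for invertible $a$, $\alpha_a^{-1}(x)=(a^* )^{-1}xa^{-1}$. A positive map $\psi$ is elementarily similar to $\varphi$ if $\varphi=\alpha_a^{-1}\circ\psi\circ\alpha_a$ for some invertible $a\in\mathcal{A}$. *)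

theory Defs
  imports "HOL-Analysis.Analysis"
begin

class cstar_algebra = real_normed_algebra_1 + banach +
  fixes cscale :: "complex \<Rightarrow> 'a \<Rightarrow> 'a"
    and adj :: "'a \<Rightarrow> 'a"
  assumes cscale_add_left: "cscale (a + b) x = cscale a x + cscale b x"
    and cscale_add_right: "cscale a (x + y) = cscale a x + cscale a y"
    and cscale_cscale: "cscale a (cscale b x) = cscale (a * b) x"
    and cscale_one: "cscale 1 x = x"
    and scaleR_cscale: "scaleR r x = cscale (complex_of_real r) x"
    and cscale_mult_left: "cscale a x * y = cscale a (x * y)"
    and cscale_mult_right: "x * cscale a y = cscale a (x * y)"
    and norm_cscale: "norm (cscale a x) = cmod a * norm x"
    and adj_adj: "adj (adj x) = x"
    and adj_add: "adj (x + y) = adj x + adj y"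
    and adj_cscale: "adj (cscale a x) = cscale (cnj a) (adj x)"
    and adj_mult: "adj (x * y) = adj y * adj x"
    and cstar_identity: "norm (adj x * x) = (norm x)\<^sup>2"

context cstar_algebra
begin

definition invertible_el :: "'a \<Rightarrow> bool" where
  "invertible_el a \<longleftrightarrow> (\<exists>b. a * b = 1 \<and> b * a = 1)"

definition inv_el :: "'a \<Rightarrow> 'a" where
  "inv_el a = (THE b. a * b = 1 \<and> b * a = 1)"

definition el_spectrum :: "'a \<Rightarrow> complex set" where
  "el_spectrum a = {z. \<not> invertible_el (a - cscale z 1)}"

definition positive_el :: "'a \<Rightarrow> bool" where
  "positive_el a \<longleftrightarrow> adj a = a \<and> el_spectrum a \<subseteq> complex_of_real ` {0..}"

definition cle :: "'a \<Rightarrow> 'a \<Rightarrow> bool" where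
  "cle x y \<longleftrightarrow> positive_el (y - x)"

definition strictly_positive :: "'a \<Rightarrow> bool" where
  "strictly_positive a \<longleftrightarrow> positive_el a \<and> invertible_el a"

definition clinear_map :: "('a \<Rightarrow> 'a) \<Rightarrow> bool" where
  "clinear_map f \<longleftrightarrow> (\<forall>x y. f (x + y) = f x + f y) \<and> (\<forall>c x. f (cscale c x) = cscale c (f x))"

definition positive_map :: "('a \<Rightarrow> 'a) \<Rightarrow> bool" where
  "positive_map f \<longleftrightarrow> clinear_map f \<and> (\<forall>x. positive_el x \<longrightarrow> positive_el (f x))"

definition alpha :: "'a \<Rightarrow> 'a \<Rightarrow> 'a" where
  "alpha a x = adj a * x * a"

definition alpha_inv :: "'a \<Rightarrow> 'a \<Rightarrow> 'a" where
  "alpha_inv a x = inv_el (adj a) * x * inv_el a"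

definition elem_similar :: "('a \<Rightarrow> 'a) \<Rightarrow> ('a \<Rightarrow> 'a) \<Rightarrow> bool" where
  "elem_similar \<psi> \<phi> \<longleftrightarrow> (\<exists>a. invertible_el a \<and> \<phi> = alpha_inv a \<circ> \<psi> \<circ> alpha a)"

definition bounded_op :: "('a \<Rightarrow> 'a) \<Rightarrow> bool" where
  "bounded_op f \<longleftrightarrow> clinear_map f \<and> (\<exists>K. \<forall>x. norm (f x) \<le> K * norm x)"

definition op_spectrum :: "('a \<Rightarrow> 'a) \<Rightarrow> complex set" where
  "op_spectrum f = {z. \<not> (\<exists>g. bounded_op g \<and>
       (\<forall>x. g (f x - cscale z x) = x) \<and> (\<forall>x. f (g x) - cscale z (g x) = x))}"

definition op_spectral_radius :: "('a \<Rightarrow> 'a) \<Rightarrow> real" where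
  "op_spectral_radius f = Sup (cmod ` op_spectrum f)"

end

end

theory Submission
  imports Defs
begin

text \<open>
  A positive map \<open>\<psi>\<close> satisfies \<open>\<parallel>\<psi>\<parallel> = \<parallel>\<psi>(1)\<parallel>\<close>. Hence if \<open>\<phi>(w) \<le> r w\<close> and \<open>v = w\<^sup>1\<^sup>/\<^sup>2\<close>, then
  \<open>\<psi> = \<alpha>\<^sub>v\<^sup>-\<^sup>1 \<circ> \<phi> \<circ> \<alpha>\<^sub>v\<close> has \<open>\<psi>(1) \<le> r\<close>, so \<open>\<parallel>\<psi>\<parallel> \<le> r\<close>, while \<open>r = r(\<psi>) \<le> \<parallel>\<psi>\<parallel>\<close> because similar
  operators have the same spectrum. Conversely, if \<open>\<phi> = \<alpha>\<^sub>a\<^sup>-\<^sup>1 \<circ> \<psi> \<circ> \<alpha>\<^sub>a\<close> and \<open>\<parallel>\<psi>\<parallel> = r\<close>, then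
  \<open>\<psi>(1) \<le> r\<close> and \<open>w = \<alpha>\<^sub>a\<^sup>-\<^sup>1(1)\<close> works.

  The norm formula is obtained without the Russo--Dye theorem: for \<open>\<parallel>x\<parallel> < 1\<close> the operator-valued
  Poisson kernel of \<open>x\<close> is positive, its averages over the \<open>n\<close>-th roots of unity, weighted by \<open>1\<close> and by
  \<open>z\<close>, tend to \<open>1\<close> and \<open>x\<close>, and a Cauchy--Schwarz inequality bounds the second average of the image
  under \<open>\<psi>\<close> by the first.
\<close>

section \<open>Inverses and geometric sums in noncommutative algebras\<close>

text \<open>A relation over an arbitrary monoid, so that the same facts serve the elements of a
  C*-algebra and the bounded operators on it.\<close>

definition inverse_pair :: "'b::monoid_mult \<Rightarrow> 'b \<Rightarrow> bool" where
  "inverse_pair a b \<longleftrightarrow> a * b = 1 \<and> b * a = 1"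

lemma inverse_pair_sym: "inverse_pair a b \<Longrightarrow> inverse_pair b a"
  by (simp add: inverse_pair_def)

lemma inverse_pair_mult:
  assumes "inverse_pair a b" "inverse_pair c d"
  shows "inverse_pair (a * c) (d * b)"
proof -
  have "a * c * (d * b) = a * (c * d) * b" "d * b * (a * c) = d * (b * a) * c"
    by (simp_all only: mult.assoc)
  then show ?thesis
    using assms by (simp add: inverse_pair_def)
qed

lemma inverse_pair_commute:
  assumes "inverse_pair a b" "a * c = c * a"
  shows "b * c = c * b"
proof -
  have "b * c = b * (c * a) * b"
    using assms(1) by (simp add: inverse_pair_def mult.assoc)
  also have "\<dots> = b * (a * c) * b"
    using assms(2) by simp
  also have "\<dots> = (b * a) * (c * b)"
    by (simp only: mult.assoc)
  also have "\<dots> = c * b"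
    using assms(1) by (simp add: inverse_pair_def)
  finally show ?thesis .
qed

text \<open>Since \<open>a\<close> commutes with \<open>a * b\<close>, it commutes with the inverse
  \<open>c\<close>, which turns the right inverse \<open>b * c\<close> into a left one. With
  \<open>a = b\<close> this makes square roots of invertible elements invertible.\<close>

lemma inverse_pair_of_commuting_product:
  assumes "inverse_pair (a * b) c" "a * b = b * a"
  shows "inverse_pair a (b * c)"
proof -
  have "(a * b) * a = a * (a * b)"
    using assms(2) by (metis mult.assoc)
  then have ca: "c * a = a * c"
    by (rule inverse_pair_commute[OF assms(1)])
  have "b * c * a = b * (a * c)"
    using ca by (simp add: mult.assoc)
  also have "\<dots> = (b * a) * c"
    by (simp only: mult.assoc)
  also have "\<dots> = 1"
    using assms by (simp add: inverse_pair_def)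
  finally have "b * c * a = 1" .
  moreover have "a * (b * c) = 1"
    using assms(1) by (simp add: inverse_pair_def mult.assoc)
  ultimately show ?thesis
    by (simp add: inverse_pair_def)
qed

lemma one_minus_mult_geometric_sum:
  fixes z :: "'b::ring_1"
  shows "(1 - z) * (\<Sum>k<n. z ^ k) = 1 - z ^ n" "(\<Sum>k<n. z ^ k) * (1 - z) = 1 - z ^ n"
proof -
  show "(1 - z) * (\<Sum>k<n. z ^ k) = 1 - z ^ n"
    by (induction n) (simp_all add: distrib_left left_diff_distrib)
  show "(\<Sum>k<n. z ^ k) * (1 - z) = 1 - z ^ n"
  proof (induction n)
    case (Suc n)
    have "(\<Sum>k<Suc n. z ^ k) * (1 - z) = (\<Sum>k<n. z ^ k) * (1 - z) + (z ^ n - z ^ n * z)"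
      by (simp add: distrib_right right_diff_distrib)
    then show ?case
      using Suc by (simp add: power_commutes)
  qed simp
qed

lemma neumann_inverse:
  fixes x :: "'b::{real_normed_algebra_1,banach}"
  assumes "norm x < 1"
  shows "\<exists>b. inverse_pair (1 - x) b"
proof -
  have sums: "(\<lambda>n. \<Sum>k<n. x ^ k) \<longlonglongrightarrow> (\<Sum>k. x ^ k)"
    using complete_algebra_summable_geometric[OF assms] by (rule summable_LIMSEQ)
  have "(\<lambda>n. 1 - x ^ n) \<longlonglongrightarrow> 1 - 0"
    by (intro tendsto_intros LIMSEQ_power_zero assms)
  then have lim: "(\<lambda>n. 1 - x ^ n) \<longlonglongrightarrow> 1"
    by simp
  have "(\<lambda>n. (1 - x) * (\<Sum>k<n. x ^ k)) \<longlonglongrightarrow> (1 - x) * (\<Sum>k. x ^ k)"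
    "(\<lambda>n. (\<Sum>k<n. x ^ k) * (1 - x)) \<longlonglongrightarrow> (\<Sum>k. x ^ k) * (1 - x)"
    by (intro tendsto_intros sums)+
  then have "inverse_pair (1 - x) (\<Sum>k. x ^ k)"
    unfolding one_minus_mult_geometric_sum inverse_pair_def
    using LIMSEQ_unique lim by blast
  then show ?thesis ..
qed

text \<open>Here \<open>q - 1 = y * q\<close> and \<open>norm q <= norm (q - 1) + 1\<close>; the
  resulting inequality is solved for \<open>norm (q - 1)\<close>.\<close>

lemma norm_inverse_minus_one_le:
  fixes y :: "'b::real_normed_algebra_1"
  assumes "inverse_pair (1 - y) q" "norm y \<le> a" "a < 1"
  shows "norm (q - 1) \<le> a / (1 - a)"
proof -
  have "q - 1 = y * q"
    using assms(1) by (simp add: inverse_pair_def algebra_simps)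
  then have le: "norm (q - 1) \<le> a * norm q"
    by (metis assms(2) mult_right_mono norm_ge_zero norm_mult_ineq order_trans)
  have "norm q \<le> norm (q - 1) + 1"
    by (metis diff_add_cancel norm_one norm_triangle_ineq)
  moreover have "0 \<le> a"
    using assms(2) norm_ge_zero order_trans by blast
  ultimately have "a * norm q \<le> a * (norm (q - 1) + 1)"
    by (intro mult_left_mono)
  then have "norm (q - 1) * (1 - a) \<le> a"
    using le by (simp add: algebra_simps)
  then show ?thesis
    using assms(3) by (simp add: pos_le_divide_eq)
qed

section \<open>Power growth and the spectrum\<close>

lemma sum_powers_root_of_unity:
  assumes "n > 0"
  shows "(\<Sum>j<n. cis (2 * pi / real n) ^ (j * k)) = (if n dvd k then of_nat n else 0)"
proof -
  let ?w = "cis (2 * pi / real n)"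
  have wn: "?w ^ n = 1"
    using assms by (subst Complex.DeMoivre) simp
  show ?thesis
  proof (cases "n dvd k")
    case True
    then have "?w ^ (j * k) = 1" for j
      using wn by (metis dvdE dvd_mult power_mult power_one)
    then show ?thesis
      using True by simp
  next
    case False
    have ne: "?w ^ k \<noteq> 1"
    proof
      assume "?w ^ k = 1"
      then have "cis (real k * (2 * pi / real n)) = 1"
        by (simp add: Complex.DeMoivre)
      then have "cos (real k * (2 * pi / real n)) = 1"
        by (metis cis.sel(1) one_complex.sel(1))
      then obtain i :: int where "real k * (2 * pi / real n) = of_int i * 2 * pi"
        unfolding cos_one_2pi_int by auto
      then have "real k = of_int i * real n"
        using assms by (simp add: field_simps)
      then have "int k = i * int n"
        by (metis (mono_tags) of_int_eq_iff of_int_mult of_int_of_nat_eq)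
      then show False
        using False by (metis dvd_triv_right int_dvd_int_iff)
    qed
    have "(\<Sum>j<n. ?w ^ (j * k)) = (\<Sum>j<n. (?w ^ k) ^ j)"
      by (simp add: power_mult[symmetric] mult.commute)
    also have "\<dots> = ((?w ^ k) ^ n - 1) / (?w ^ k - 1)"
      by (rule geometric_sum[OF ne])
    also have "(?w ^ k) ^ n = 1"
      by (metis mult.commute power_mult power_one wn)
    finally show ?thesis
      using False by simp
  qed
qed

text \<open>Complex scalars enter a real normed algebra through a central embedding
  \<open>\<iota>\<close>. The resolvent arguments are thus carried out once, for a C*-algebra and
  for the algebra of operators on it.\<close>

locale central_scalars =
  fixes \<iota> :: "complex \<Rightarrow> 'b::real_normed_algebra_1"
  assumes iota_add: "\<iota> (c + d) = \<iota> c + \<iota> d"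
    and iota_mult: "\<iota> (c * d) = \<iota> c * \<iota> d"
    and iota_one [simp]: "\<iota> 1 = 1"
    and iota_central: "x * \<iota> c = \<iota> c * x"
    and norm_iota_mult: "norm (\<iota> c * x) = cmod c * norm x"
begin

lemma iota_zero [simp]: "\<iota> 0 = 0"
  using iota_add[of 0 0] by simp

lemma iota_diff: "\<iota> (c - d) = \<iota> c - \<iota> d"
  by (metis add_diff_cancel_right' diff_add_cancel iota_add)

lemma iota_sum: "\<iota> (\<Sum>j\<in>A. f j) = (\<Sum>j\<in>A. \<iota> (f j))"
  by (induction A rule: infinite_finite_induct) (simp_all add: iota_add)

lemma iota_of_nat [simp]: "\<iota> (of_nat n) = of_nat n"
  by (induction n) (simp_all add: iota_add)

lemma iota_mult_power: "(\<iota> c * x) ^ n = \<iota> (c ^ n) * x ^ n"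
proof (induction n)
  case (Suc n)
  have "(\<iota> c * x) ^ Suc n = \<iota> c * (x * \<iota> (c ^ n)) * x ^ n"
    using Suc by (simp add: mult.assoc)
  also have "\<dots> = \<iota> c * (\<iota> (c ^ n) * x) * x ^ n"
    by (simp only: iota_central[of x])
  finally show ?case
    by (simp add: iota_mult mult.assoc)
qed simp

text \<open>With \<open>w = cis (2 * pi / real n)\<close>, all the elements
  \<open>\<iota> (w ^ j) * y\<close> have the same \<open>n\<close>-th power \<open>y ^ n\<close>,
  so \<open>(1 - y ^ n) * G j\<close> is a finite geometric sum. By orthogonality of the roots of
  unity, the weights \<open>w ^ (j * e)\<close> leave only the power of \<open>y\<close> whose
  exponent is congruent to \<open>- e\<close> modulo \<open>n\<close>.\<close>

lemma resolvent_averages: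
  assumes n: "n > 0" and e: "e < n"
    and G: "\<And>j. j < n \<Longrightarrow> inverse_pair (1 - \<iota> (cis (2 * pi / real n) ^ j) * y) (G j)"
  shows "(1 - y ^ n) * (\<Sum>j<n. \<iota> (cis (2 * pi / real n) ^ (j * e)) * G j)
      = of_nat n * y ^ ((n - e) mod n)"
    and "(\<Sum>j<n. \<iota> (cis (2 * pi / real n) ^ (j * e)) * G j) * (1 - y ^ n)
      = of_nat n * y ^ ((n - e) mod n)"
proof -
  let ?w = "cis (2 * pi / real n)"
  have wn: "?w ^ n = 1"
    using n by (subst Complex.DeMoivre) simp
  have zn: "(\<iota> (?w ^ j) * y) ^ n = y ^ n" for j
  proof -
    have "(?w ^ j) ^ n = 1"
      by (metis mult.commute power_mult power_one wn)
    then show ?thesis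
      by (simp add: iota_mult_power)
  qed
  have G1: "(1 - y ^ n) * G j = (\<Sum>k<n. (\<iota> (?w ^ j) * y) ^ k)" if "j < n" for j
  proof -
    have "(1 - y ^ n) * G j = (\<Sum>k<n. (\<iota> (?w ^ j) * y) ^ k) * ((1 - \<iota> (?w ^ j) * y) * G j)"
      using one_minus_mult_geometric_sum(2)[of "\<iota> (?w ^ j) * y" n] by (simp add: zn mult.assoc[symmetric])
    then show ?thesis
      using G[OF that] by (simp add: inverse_pair_def)
  qed
  have G2: "G j * (1 - y ^ n) = (\<Sum>k<n. (\<iota> (?w ^ j) * y) ^ k)" if "j < n" for j
  proof -
    have "G j * (1 - y ^ n) = (G j * (1 - \<iota> (?w ^ j) * y)) * (\<Sum>k<n. (\<iota> (?w ^ j) * y) ^ k)"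
      using one_minus_mult_geometric_sum(1)[of "\<iota> (?w ^ j) * y" n] by (simp add: zn mult.assoc)
    then show ?thesis
      using G[OF that] by (simp add: inverse_pair_def)
  qed
  \<comment> \<open>As \<open>e + k < 2 * n\<close>, the multiple is \<open>0\<close> or
    \<open>n\<close>. The outer \<open>mod n\<close> is for \<open>e = 0\<close>, where the
    surviving exponent is \<open>0\<close> and not \<open>n\<close>.\<close>
  have dvd_iff: "n dvd e + k \<longleftrightarrow> k = (n - e) mod n" if "k < n" for k
  proof
    assume "n dvd e + k"
    then obtain c where c: "e + k = n * c" ..
    have "c < 2"
    proof (rule ccontr)
      assume "\<not> c < 2"
      then have "n * 2 \<le> n * c"
        by (intro mult_le_mono2) simp
      then show False
        using c that e by linarith
    qed
    then have "c = 0 \<or> c = 1" by auto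
    then show "k = (n - e) mod n"
      using c e that by auto
  next
    assume "k = (n - e) mod n"
    then show "n dvd e + k"
      using e by (cases "e = 0") auto
  qed
  have "(\<Sum>j<n. \<iota> (?w ^ (j * e)) * (\<Sum>k<n. (\<iota> (?w ^ j) * y) ^ k))
      = (\<Sum>j<n. \<Sum>k<n. \<iota> (?w ^ (j * (e + k))) * y ^ k)"
    by (simp add: sum_distrib_left iota_mult_power mult.assoc[symmetric] iota_mult[symmetric]
        power_mult[symmetric] power_add[symmetric] distrib_left)
  also have "\<dots> = (\<Sum>k<n. \<iota> (\<Sum>j<n. ?w ^ (j * (e + k))) * y ^ k)"
    by (subst sum.swap) (simp add: iota_sum sum_distrib_right)
  also have "\<dots> = (\<Sum>k<n. if k = (n - e) mod n then of_nat n * y ^ k else 0)"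
    using n by (intro sum.cong) (simp_all add: sum_powers_root_of_unity dvd_iff)
  also have "\<dots> = of_nat n * y ^ ((n - e) mod n)"
    using n by simp
  finally have main: "(\<Sum>j<n. \<iota> (?w ^ (j * e)) * (\<Sum>k<n. (\<iota> (?w ^ j) * y) ^ k))
      = of_nat n * y ^ ((n - e) mod n)" .
  have "(1 - y ^ n) * (\<Sum>j<n. \<iota> (?w ^ (j * e)) * G j)
      = (\<Sum>j<n. \<iota> (?w ^ (j * e)) * ((1 - y ^ n) * G j))"
    by (simp only: sum_distrib_left mult.assoc[symmetric] iota_central[of "1 - y ^ n"])
  then show "(1 - y ^ n) * (\<Sum>j<n. \<iota> (?w ^ (j * e)) * G j) = of_nat n * y ^ ((n - e) mod n)"
    using main by (simp add: G1)
  have "(\<Sum>j<n. \<iota> (?w ^ (j * e)) * G j) * (1 - y ^ n)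
      = (\<Sum>j<n. \<iota> (?w ^ (j * e)) * (G j * (1 - y ^ n)))"
    by (simp add: sum_distrib_right mult.assoc)
  then show "(\<Sum>j<n. \<iota> (?w ^ (j * e)) * G j) * (1 - y ^ n) = of_nat n * y ^ ((n - e) mod n)"
    using main by (simp add: G2)
qed

section \<open>Continuity of the resolvent and decay of powers\<close>

lemma resolvent_identity:
  assumes "inverse_pair (1 - \<iota> \<mu> * x) g" "inverse_pair (1 - \<iota> \<nu> * x) h"
  shows "g - h = \<iota> (\<mu> - \<nu>) * (g * x * h)"
proof -
  have scal: "g * (\<iota> c * x) * h = \<iota> c * (g * x * h)" for c
    by (simp only: mult.assoc[symmetric] iota_central[of g])
  have "g - h = g * ((1 - \<iota> \<nu> * x) * h) - (g * (1 - \<iota> \<mu> * x)) * h"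
    using assms by (simp add: inverse_pair_def)
  also have "\<dots> = g * (\<iota> \<mu> * x) * h - g * (\<iota> \<nu> * x) * h"
    by (simp add: left_diff_distrib right_diff_distrib mult.assoc)
  finally show ?thesis
    by (simp add: scal iota_diff left_diff_distrib)
qed

text \<open>The resolvent identity bounds the increment by
  \<open>cmod (\<nu> - \<mu>) * norm (G \<nu>)\<close> times a constant. For \<open>\<nu>\<close>
  near \<open>\<mu>\<close> this is at most half of \<open>norm (G \<nu>)\<close>, whence
  \<open>norm (G \<nu>) <= 2 * norm (G \<mu>)\<close> and the bound becomes linear in
  \<open>cmod (\<nu> - \<mu>)\<close>.\<close>

lemma continuous_on_resolvent:
  assumes G: "\<And>\<mu>. \<mu> \<in> S \<Longrightarrow> inverse_pair (1 - \<iota> \<mu> * x) (G \<mu>)"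
  shows "continuous_on S G"
  unfolding continuous_on_def
proof
  fix \<mu> assume \<mu>: "\<mu> \<in> S"
  let ?K = "norm x * norm (G \<mu>)"
  have bound: "norm (G \<nu> - G \<mu>) \<le> cmod (\<nu> - \<mu>) * (2 * norm (G \<mu>) * ?K)"
    if \<nu>: "\<nu> \<in> S" and small: "cmod (\<nu> - \<mu>) * ?K < 1 / 2" for \<nu>
  proof -
    have "norm (G \<nu> - G \<mu>) = cmod (\<nu> - \<mu>) * norm (G \<nu> * x * G \<mu>)"
      using resolvent_identity[OF G[OF \<nu>] G[OF \<mu>]] norm_iota_mult by simp
    also have "\<dots> \<le> cmod (\<nu> - \<mu>) * (norm (G \<nu>) * ?K)"
    proof (rule mult_left_mono)
      have "norm (G \<nu> * x * G \<mu>) \<le> norm (G \<nu> * x) * norm (G \<mu>)"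
        by (rule norm_mult_ineq)
      also have "\<dots> \<le> norm (G \<nu>) * norm x * norm (G \<mu>)"
        by (intro mult_right_mono norm_mult_ineq) simp
      finally show "norm (G \<nu> * x * G \<mu>) \<le> norm (G \<nu>) * ?K"
        by (simp add: mult.assoc)
    qed simp
    finally have le: "norm (G \<nu> - G \<mu>) \<le> cmod (\<nu> - \<mu>) * (norm (G \<nu>) * ?K)" .
    have "cmod (\<nu> - \<mu>) * (norm (G \<nu>) * ?K) = norm (G \<nu>) * (cmod (\<nu> - \<mu>) * ?K)"
      by simp
    also have "\<dots> \<le> norm (G \<nu>) * (1 / 2)"
      using small by (intro mult_left_mono) auto
    finally have "norm (G \<nu> - G \<mu>) \<le> norm (G \<nu>) * (1 / 2)"
      using le by linarith
    moreover have "norm (G \<nu>) \<le> norm (G \<nu> - G \<mu>) + norm (G \<mu>)"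
      by (metis diff_add_cancel norm_triangle_ineq)
    ultimately have "norm (G \<nu>) \<le> 2 * norm (G \<mu>)"
      by linarith
    then have "cmod (\<nu> - \<mu>) * (norm (G \<nu>) * ?K) \<le> cmod (\<nu> - \<mu>) * (2 * norm (G \<mu>) * ?K)"
      by (intro mult_left_mono mult_right_mono) auto
    with le show ?thesis
      by linarith
  qed
  have lim: "((\<lambda>\<nu>. cmod (\<nu> - \<mu>) * C) \<longlongrightarrow> 0) (at \<mu> within S)" for C
  proof -
    have "((\<lambda>\<nu>. cmod (\<nu> - \<mu>) * C) \<longlongrightarrow> cmod (\<mu> - \<mu>) * C) (at \<mu> within S)"
      by (intro tendsto_intros)
    then show ?thesis by simp
  qed
  have "eventually (\<lambda>\<nu>. cmod (\<nu> - \<mu>) * ?K < 1 / 2) (at \<mu> within S)"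
    by (rule order_tendstoD(2)[OF lim]) simp
  moreover have "eventually (\<lambda>\<nu>. \<nu> \<in> S) (at \<mu> within S)"
    by (simp add: eventually_at_filter)
  ultimately have "eventually (\<lambda>\<nu>. norm (G \<nu> - G \<mu>) \<le> cmod (\<nu> - \<mu>) * (2 * norm (G \<mu>) * ?K)) (at \<mu> within S)"
    by eventually_elim (rule bound)
  then have "((\<lambda>\<nu>. G \<nu> - G \<mu>) \<longlongrightarrow> 0) (at \<mu> within S)"
    by (rule Lim_null_comparison) (rule lim)
  then show "(G \<longlongrightarrow> G \<mu>) (at \<mu> within S)"
    by (simp add: LIM_zero_iff)
qed

text \<open>
  Rickart's function-theory-free argument. The average of the resolvents over the circle of radius
  \<open>s\<close> is the inverse of \<open>1 - s\<^sup>n x\<^sup>n\<close>; it is uniformly continuous in \<open>s\<close>, uniformly in \<open>n\<close>. Hence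
  \<open>s\<^sup>n x\<^sup>n \<rightarrow> 0\<close> propagates from one radius to all slightly larger ones.
\<close>

lemma powers_tendsto_zero_of_resolvent:
  assumes G: "\<And>\<mu>. cmod \<mu> \<le> m \<Longrightarrow> inverse_pair (1 - \<iota> \<mu> * x) (G \<mu>)"
    and u: "0 \<le> u" "u < m"
  shows "(\<lambda>n. norm (x ^ n) * u ^ n) \<longlonglongrightarrow> 0"
proof -
  have "continuous_on (cball 0 m) G"
    by (rule continuous_on_resolvent[where x = x]) (simp add: G)
  then have "uniformly_continuous_on (cball 0 m) G"
    by (rule compact_uniformly_continuous) simp
  then obtain \<delta> where \<delta>: "\<delta> > 0"
    and unif: "\<And>\<mu> \<nu>. cmod \<mu> \<le> m \<Longrightarrow> cmod \<nu> \<le> m \<Longrightarrow> cmod (\<mu> - \<nu>) < \<delta> \<Longrightarrow> norm (G \<mu> - G \<nu>) < 1 / 3"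
    unfolding uniformly_continuous_on_def
    by (metis dist_norm mem_cball_0 zero_less_divide_1_iff zero_less_numeral)
  define Q where
    "Q n s = (1 / real n) *\<^sub>R (\<Sum>j<n. G (cis (2 * pi / real n) ^ j * complex_of_real s))" for n s
  have Q: "inverse_pair (1 - \<iota> (complex_of_real s ^ n) * x ^ n) (Q n s)"
    if "n > 0" "0 \<le> s" "s \<le> m" for n s
  proof -
    let ?w = "cis (2 * pi / real n)"
    have "inverse_pair (1 - \<iota> (?w ^ j) * (\<iota> (complex_of_real s) * x)) (G (?w ^ j * complex_of_real s))" for j
      using G[of "?w ^ j * complex_of_real s"] that
      by (simp add: iota_mult mult.assoc norm_mult norm_power)
    note avg = resolvent_averages[OF that(1) that(1) this]
    have "(1 - (\<iota> (complex_of_real s) * x) ^ n) * (\<Sum>j<n. G (?w ^ j * complex_of_real s)) = of_nat n"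
      "(\<Sum>j<n. G (?w ^ j * complex_of_real s)) * (1 - (\<iota> (complex_of_real s) * x) ^ n) = of_nat n"
      using avg by simp_all
    moreover have "(1 / real n) *\<^sub>R (of_nat n :: 'b) = 1"
    proof -
      have "(of_nat n :: 'b) = real n *\<^sub>R 1"
        by (simp add: of_real_def[symmetric])
      then show ?thesis
        using that(1) by simp
    qed
    ultimately show ?thesis
      by (simp add: inverse_pair_def Q_def iota_mult_power)
  qed
  have Q_diff: "norm (Q n t - Q n s) \<le> 1 / 3"
    if "n > 0" "0 \<le> s" "s \<le> m" "0 \<le> t" "t \<le> m" "\<bar>t - s\<bar> < \<delta>" for n s t
  proof -
    let ?w = "cis (2 * pi / real n)"
    have "norm (G (?w ^ j * complex_of_real t) - G (?w ^ j * complex_of_real s)) \<le> 1 / 3" for j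
    proof -
      have "cmod (?w ^ j * complex_of_real t - ?w ^ j * complex_of_real s) = \<bar>t - s\<bar>"
        by (simp add: right_diff_distrib[symmetric] norm_mult norm_power del: of_real_diff
            add: of_real_diff[symmetric])
      then show ?thesis
        using that by (intro less_imp_le[OF unif]) (simp_all add: norm_mult norm_power)
    qed
    then have "norm (\<Sum>j<n. G (?w ^ j * complex_of_real t) - G (?w ^ j * complex_of_real s)) \<le> (\<Sum>j<n. 1 / 3)"
      by (intro sum_norm_le)
    moreover have "Q n t - Q n s
        = (1 / real n) *\<^sub>R (\<Sum>j<n. G (?w ^ j * complex_of_real t) - G (?w ^ j * complex_of_real s))"
      by (simp add: Q_def scaleR_diff_right sum_subtractf)
    ultimately show ?thesis
      using that(1) by (simp add: pos_divide_le_eq)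
  qed
  \<comment> \<open>Eventually \<open>s ^ n * x ^ n\<close> has norm at most 1/6, so
    \<open>Q n s\<close> lies within 1/5 of 1. Uniform continuity puts \<open>Q n t\<close> within
    1/5 + 1/3 < 2/3 of 1, so its inverse has norm at most 3. This bounds
    \<open>t ^ n * x ^ n\<close> by 4, and any \<open>u < t\<close> gains the factor
    \<open>(u / t) ^ n\<close>.\<close>
  have step: "(\<lambda>n. norm (x ^ n) * u ^ n) \<longlonglongrightarrow> 0"
    if lim: "(\<lambda>n. norm (x ^ n) * s ^ n) \<longlonglongrightarrow> 0"
      and bounds: "0 \<le> s" "s \<le> t" "t \<le> m" "t - s < \<delta>" "0 \<le> u" "u < t" for s t u
  proof -
    have "eventually (\<lambda>n. norm (x ^ n) * s ^ n < 1 / 6) sequentially"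
      by (rule order_tendstoD(2)[OF lim]) simp
    then have ev: "eventually (\<lambda>n. norm (norm (x ^ n) * u ^ n) \<le> 4 * (u / t) ^ n) sequentially"
      using eventually_gt_at_top[of 0]
    proof eventually_elim
      case (elim n)
      have ns: "norm (\<iota> (complex_of_real s ^ n) * x ^ n) \<le> 1 / 6"
        using elim(1) bounds by (simp add: norm_iota_mult norm_power mult.commute)
      have "norm (Q n s - 1) \<le> (1 / 6) / (1 - 1 / 6)"
        using Q[OF elim(2), of s] bounds by (intro norm_inverse_minus_one_le[OF _ ns]) auto
      moreover have "norm (Q n t - Q n s) \<le> 1 / 3"
        using bounds elim(2) by (intro Q_diff) auto
      moreover have "norm (Q n t - 1) \<le> norm (Q n t - Q n s) + norm (Q n s - 1)"
        by (metis diff_add_cancel add_diff_eq norm_triangle_ineq)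
      ultimately have Qt: "norm (1 - Q n t) \<le> 2 / 3"
        by (simp add: norm_minus_commute)
      define W where "W = 1 - \<iota> (complex_of_real t ^ n) * x ^ n"
      have "W * Q n t = 1"
        using Q[OF elim(2), of t] bounds by (simp add: W_def inverse_pair_def)
      then have "W = 1 + W * (1 - Q n t)"
        by (simp add: algebra_simps)
      then have "norm W \<le> 1 + norm W * norm (1 - Q n t)"
        by (metis add_left_mono norm_mult_ineq norm_one norm_triangle_ineq order_trans)
      also have "\<dots> \<le> 1 + norm W * (2 / 3)"
        using Qt by (intro add_left_mono mult_left_mono) auto
      finally have W3: "norm W \<le> 3"
        by simp
      have "\<iota> (complex_of_real t ^ n) * x ^ n = 1 - W"
        by (simp add: W_def)
      then have "norm (\<iota> (complex_of_real t ^ n) * x ^ n) \<le> 4"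
        using W3 norm_triangle_ineq4[of 1 W] by simp
      then have "t ^ n * norm (x ^ n) \<le> 4"
        using bounds by (simp add: norm_iota_mult norm_power)
      then have "t ^ n * norm (x ^ n) * (u / t) ^ n \<le> 4 * (u / t) ^ n"
        using bounds by (intro mult_right_mono) auto
      moreover have "t ^ n * norm (x ^ n) * (u / t) ^ n = norm (x ^ n) * u ^ n"
        using bounds by (simp add: power_divide)
      ultimately show ?case
        using bounds by simp
    qed
    have "(\<lambda>n. 4 * (u / t) ^ n) \<longlonglongrightarrow> 4 * 0"
      using bounds by (intro tendsto_intros LIMSEQ_power_zero) simp
    then have "(\<lambda>n. 4 * (u / t) ^ n) \<longlonglongrightarrow> 0"
      by simp
    with ev show ?thesis
      by (rule Lim_null_comparison)
  qed
  have "0 \<le> v \<Longrightarrow> v < m \<Longrightarrow> v \<le> real k * (\<delta> / 2) \<Longrightarrow> (\<lambda>n. norm (x ^ n) * v ^ n) \<longlonglongrightarrow> 0" for k v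
  proof (induction k arbitrary: v)
    case 0
    then have v: "v = 0"
      by simp
    \<comment> \<open>At \<open>n = 0\<close> the term is 1 because \<open>0 ^ 0 = 1\<close>; it
      vanishes from \<open>n = 1\<close> on.\<close>
    have "eventually (\<lambda>n. norm (x ^ n) * v ^ n = 0) sequentially"
      using eventually_gt_at_top[of 0] by eventually_elim (simp add: v)
    then show ?case
      by (rule tendsto_eventually)
  next
    case (Suc k)
    \<comment> \<open>The known radius \<open>max 0 (v - \<delta> / 2)\<close> and the intermediate
      radius \<open>min m (v + \<delta> / 4)\<close> differ by at most three quarters of
      \<open>\<delta>\<close>, and the latter still exceeds \<open>v\<close>.\<close>
    have "(\<lambda>n. norm (x ^ n) * (max 0 (v - \<delta> / 2)) ^ n) \<longlonglongrightarrow> 0"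
      using Suc.prems \<delta> by (intro Suc.IH) (auto simp: max_def algebra_simps)
    then show ?case
      by (rule step[where t = "min m (v + \<delta> / 4)"])
        (use Suc.prems \<delta> in \<open>auto simp: max_def min_def\<close>)
  qed
  moreover obtain k :: nat where "u / (\<delta> / 2) \<le> real k"
    using real_arch_simple by blast
  ultimately show ?thesis
    using u \<delta> by (simp add: pos_divide_le_eq)
qed

end

section \<open>The positive cone of a C*-algebra\<close>

lemma adj_zero [simp]: "adj 0 = 0"
  by (metis add_cancel_right_left adj_add)

lemma adj_minus [simp]: "adj (- x) = - adj x"
  by (metis adj_add adj_zero add.right_inverse add_eq_0_iff)

lemma adj_diff: "adj (x - y) = adj x - adj y"
  by (metis adj_add adj_minus diff_conv_add_uminus)

lemma adj_one [simp]: "adj 1 = 1"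
  by (metis adj_adj adj_mult mult.left_neutral mult.right_neutral)

lemma adj_scaleR: "adj (scaleR r x) = scaleR r (adj x)"
  by (simp add: scaleR_cscale adj_cscale)

lemma adj_sum: "adj (\<Sum>i\<in>I. f i) = (\<Sum>i\<in>I. adj (f i))"
  by (induction I rule: infinite_finite_induct) (simp_all add: adj_add)

lemma adj_power: "adj (x ^ n) = adj x ^ n"
  by (induction n) (simp_all add: adj_mult power_commutes)

lemma cscale_one_mult [simp]: "cscale c 1 * x = cscale c x"
  by (simp add: cscale_mult_left)

lemma cscale_zero_left [simp]: "cscale 0 x = 0"
  by (metis add_cancel_right_left cscale_add_left)

lemma cscale_zero_right [simp]: "cscale c 0 = 0"
  by (metis add_cancel_right_left cscale_add_right)

lemma cscale_minus_right: "cscale c (- x) = - cscale c x"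
  by (metis cscale_add_right cscale_zero_right add.right_inverse add_eq_0_iff)

lemma cscale_minus_left: "cscale (- c) x = - cscale c x"
  by (metis cscale_add_left cscale_zero_left add.right_inverse add_eq_0_iff)

lemma cscale_diff_right: "cscale c (x - y) = cscale c x - cscale c y"
  by (metis cscale_add_right cscale_minus_right diff_conv_add_uminus)

lemma norm_adj [simp]: "norm (adj x) = norm x"
proof -
  have le: "norm y \<le> norm (adj y)" for y
  proof (cases "y = 0")
    case False
    have "norm y * norm y \<le> norm (adj y) * norm y"
      using norm_mult_ineq[of "adj y" y] by (simp add: cstar_identity power2_eq_square)
    then show ?thesis
      using False by simp
  qed simp
  show ?thesis
    using le[of x] le[of "adj x"] by (simp add: adj_adj)
qed

lemma norm_square_self_adjoint: "adj h = h \<Longrightarrow> norm (h * h) = (norm h)\<^sup>2"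
  using cstar_identity[of h] by simp

lemma adj_mult_eq_zero: "adj x * x = 0 \<Longrightarrow> x = 0"
  using cstar_identity[of x] by simp

lemma bounded_linear_adj: "bounded_linear (adj :: 'a::cstar_algebra \<Rightarrow> 'a)"
  by (rule bounded_linear_intro[where K = 1]) (simp_all add: adj_add adj_scaleR)

interpretation cscale: central_scalars "\<lambda>c. cscale c (1 :: 'a::cstar_algebra)"
  by standard
    (simp_all add: cscale_add_left cscale_cscale cscale_one norm_cscale cscale_mult_right mult.commute)

lemma adj_of_real [simp]: "adj (of_real t) = (of_real t :: 'a::cstar_algebra)"
  by (simp add: of_real_def adj_scaleR)

lemma cscale_of_real_one: "cscale (complex_of_real t) 1 = (of_real t :: 'a::cstar_algebra)"
  by (simp add: of_real_def scaleR_cscale)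

lemma invertible_el_iff: "invertible_el a \<longleftrightarrow> (\<exists>b. inverse_pair a (b :: 'a::cstar_algebra))"
  by (simp add: invertible_el_def inverse_pair_def)

lemma inv_el_eq:
  assumes "inverse_pair a (b :: 'a::cstar_algebra)"
  shows "inv_el a = b"
  unfolding inv_el_def
proof (rule the_equality)
  show "a * b = 1 \<and> b * a = 1"
    using assms by (simp add: inverse_pair_def)
  fix c assume "a * c = 1 \<and> c * a = 1"
  then show "c = b"
    using assms by (metis inverse_pair_def mult.assoc mult.left_neutral mult.right_neutral)
qed

lemma inverse_pair_adj:
  "inverse_pair a (b :: 'a::cstar_algebra) \<Longrightarrow> inverse_pair (adj a) (adj b)"
  by (simp add: inverse_pair_def adj_mult[symmetric])

lemma inverse_pair_cscale:
  assumes "inverse_pair a (b :: 'a::cstar_algebra)" "c \<noteq> 0"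
  shows "inverse_pair (cscale c a) (cscale (1 / c) b)"
  using assms by (simp add: inverse_pair_def cscale_mult_left cscale_mult_right cscale_cscale cscale_one)

lemma not_in_el_spectrum_iff:
  "z \<notin> el_spectrum (a :: 'a::cstar_algebra) \<longleftrightarrow> (\<exists>b. inverse_pair (a - cscale z 1) b)"
  by (simp add: el_spectrum_def invertible_el_iff)

lemma el_spectrum_shift:
  "z \<in> el_spectrum (a :: 'a::cstar_algebra) \<Longrightarrow> z + w \<in> el_spectrum (a + cscale w 1)"
  by (simp add: el_spectrum_def cscale_add_left)

lemma el_spectrum_cscale:
  assumes "z \<in> el_spectrum (a :: 'a::cstar_algebra)" "c \<noteq> 0"
  shows "c * z \<in> el_spectrum (cscale c a)"
proof (rule ccontr)
  assume "c * z \<notin> el_spectrum (cscale c a)"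
  then obtain b where "inverse_pair (cscale c a - cscale (c * z) 1) b"
    by (auto simp: not_in_el_spectrum_iff)
  then have "inverse_pair (cscale (1 / c) (cscale c a - cscale (c * z) 1)) (cscale (1 / (1 / c)) b)"
    using assms(2) by (intro inverse_pair_cscale) simp_all
  then have "inverse_pair (a - cscale z 1) (cscale (1 / (1 / c)) b)"
    using assms(2) by (simp add: cscale_diff_right cscale_cscale cscale_one)
  then show False
    using assms(1) not_in_el_spectrum_iff by blast
qed

lemma el_spectrum_minus:
  "z \<in> el_spectrum (a :: 'a::cstar_algebra) \<Longrightarrow> - z \<in> el_spectrum (- a)"
  using el_spectrum_cscale[of z a "- 1"] by (simp add: cscale_minus_left cscale_one)

lemma el_spectrum_of_real_diff:
  "z \<in> el_spectrum (a :: 'a::cstar_algebra) \<Longrightarrow> complex_of_real t - z \<in> el_spectrum (of_real t - a)"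
  using el_spectrum_shift[OF el_spectrum_minus[of z a], of "complex_of_real t"]
  by (simp add: cscale_of_real_one)

lemma cmod_le_norm_of_el_spectrum:
  assumes "z \<in> el_spectrum (a :: 'a::cstar_algebra)"
  shows "cmod z \<le> norm a"
proof (rule ccontr)
  assume less: "\<not> cmod z \<le> norm a"
  then have z: "z \<noteq> 0" by auto
  have "norm (cscale (1 / z) a) < 1"
    using less z by (simp add: norm_cscale norm_divide divide_simps)
  then obtain b where "inverse_pair (1 - cscale (1 / z) a) b"
    using neumann_inverse by blast
  from inverse_pair_cscale[OF this, of "- z"]
  have "inverse_pair (a - cscale z 1) (cscale (1 / - z) b)"
    using z by (simp add: cscale_diff_right cscale_cscale cscale_minus_left cscale_one)
  then show False
    using assms not_in_el_spectrum_iff by blast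
qed

text \<open>Arens' trick: compare \<open>\<bar>z + \<i>t\<bar>\<^sup>2\<close> with \<open>\<parallel>h + \<i>t\<parallel>\<^sup>2 \<le> \<parallel>h\<parallel>\<^sup>2 + t\<^sup>2\<close> for large \<open>t\<close>.\<close>

lemma el_spectrum_self_adjoint_real:
  assumes "adj h = (h :: 'a::cstar_algebra)" "z \<in> el_spectrum h"
  shows "Im z = 0"
proof (rule ccontr)
  assume im: "Im z \<noteq> 0"
  \<comment> \<open>The sign follows that of \<open>Im z\<close>, and \<open>2 * Im z * t\<close> is
    one more than the square of \<open>norm h\<close>, which yields the contradiction.\<close>
  define t where "t = ((norm h)\<^sup>2 + 1) / (2 * Im z)"
  define w where "w = complex_of_real t * \<i>"
  have ww: "w * w = - complex_of_real (t\<^sup>2)"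
    by (simp add: w_def power2_eq_square complex_eq_iff)
  have "adj (h + cscale w 1) = h - cscale w 1"
    using assms(1) by (simp add: w_def adj_add adj_cscale cscale_minus_left)
  then have "adj (h + cscale w 1) * (h + cscale w 1) = h * h - cscale (w * w) 1"
    by (simp add: left_diff_distrib distrib_left cscale_mult_right cscale_diff_right cscale_cscale)
  also have "\<dots> = h * h + of_real (t\<^sup>2)"
    by (simp only: ww cscale_minus_left cscale_of_real_one) simp
  finally have "adj (h + cscale w 1) * (h + cscale w 1) = h * h + of_real (t\<^sup>2)" .
  then have "(norm (h + cscale w 1))\<^sup>2 \<le> norm (h * h) + norm (of_real (t\<^sup>2) :: 'a)"
    by (metis cstar_identity norm_triangle_ineq)
  then have "(norm (h + cscale w 1))\<^sup>2 \<le> (norm h)\<^sup>2 + t\<^sup>2"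
    by (simp add: norm_square_self_adjoint[OF assms(1)] del: of_real_power)
  moreover have "(cmod (z + w))\<^sup>2 \<le> (norm (h + cscale w 1))\<^sup>2"
    using cmod_le_norm_of_el_spectrum[OF el_spectrum_shift[OF assms(2), of w]] by (intro power_mono) simp_all
  moreover have "(cmod (z + w))\<^sup>2 = (Re z)\<^sup>2 + (Im z)\<^sup>2 + 2 * Im z * t + t\<^sup>2"
    unfolding cmod_power2 by (simp add: w_def power2_eq_square algebra_simps)
  moreover have "2 * Im z * t = (norm h)\<^sup>2 + 1"
    using im by (simp add: t_def)
  ultimately show False
    using zero_le_power2[of "Re z"] zero_le_power2[of "Im z"] by linarith
qed

lemma norm_power_self_adjoint:
  assumes "adj h = (h :: 'a::cstar_algebra)"
  shows "norm (h ^ (2 ^ k)) = norm h ^ (2 ^ k)"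
proof (induction k)
  case (Suc k)
  have "norm (h ^ (2 ^ Suc k)) = norm (h ^ (2 ^ k) * h ^ (2 ^ k))"
    by (simp add: power_add[symmetric] mult_2)
  also have "\<dots> = (norm (h ^ (2 ^ k)))\<^sup>2"
    by (rule norm_square_self_adjoint) (simp add: adj_power assms)
  finally show ?case
    by (simp add: Suc power_mult[symmetric] mult.commute)
qed simp

text \<open>A \<open>\<rho>1\<close> strictly between \<open>\<rho>\<close> and
  \<open>norm h\<close> gives resolvents on the disc of radius \<open>1 / \<rho>1\<close>, so
  \<open>norm (h ^ n) / norm h ^ n\<close> tends to 0. The C*-identity keeps this quotient at 1
  along the exponents \<open>n = 2 ^ k\<close>.\<close>

lemma norm_le_of_el_spectrum:
  assumes h: "adj h = (h :: 'a::cstar_algebra)" and \<rho>: "0 \<le> \<rho>"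
    and spec: "\<And>z. z \<in> el_spectrum h \<Longrightarrow> cmod z \<le> \<rho>"
  shows "norm h \<le> \<rho>"
proof (rule ccontr)
  assume "\<not> norm h \<le> \<rho>"
  then obtain \<rho>1 where \<rho>1: "\<rho> < \<rho>1" "\<rho>1 < norm h"
    using dense[of \<rho> "norm h"] by auto
  have pos: "0 < \<rho>1" "0 < norm h"
    using \<rho> \<rho>1 by linarith+
  have "\<exists>b. inverse_pair (1 - cscale \<mu> 1 * h) b" if "cmod \<mu> \<le> 1 / \<rho>1" for \<mu>
  proof (cases "\<mu> = 0")
    case True
    then show ?thesis
      by (auto simp: inverse_pair_def intro: exI[of _ 1])
  next
    case False
    have "\<rho>1 \<le> cmod (1 / \<mu>)"
      using that False pos by (simp add: norm_divide field_simps)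
    then have "1 / \<mu> \<notin> el_spectrum h"
      using spec[of "1 / \<mu>"] \<rho>1 by linarith
    then obtain b where "inverse_pair (h - cscale (1 / \<mu>) 1) b"
      by (auto simp: not_in_el_spectrum_iff)
    from inverse_pair_cscale[OF this, of "- \<mu>"] show ?thesis
      using False by (auto simp: cscale_diff_right cscale_cscale cscale_minus_left cscale_one)
  qed
  then obtain G where G: "\<And>\<mu>. cmod \<mu> \<le> 1 / \<rho>1 \<Longrightarrow> inverse_pair (1 - cscale \<mu> 1 * h) (G \<mu>)"
    by metis
  have "(\<lambda>n. norm (h ^ n) * (1 / norm h) ^ n) \<longlonglongrightarrow> 0"
    by (rule cscale.powers_tendsto_zero_of_resolvent[OF G])
      (use \<rho>1 pos in \<open>auto intro: divide_strict_left_mono\<close>)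
  then have "eventually (\<lambda>n. norm (h ^ n) * (1 / norm h) ^ n < 1) sequentially"
    by (rule order_tendstoD(2)) simp
  then obtain N where N: "\<And>n. n \<ge> N \<Longrightarrow> norm (h ^ n) * (1 / norm h) ^ n < 1"
    by (auto simp: eventually_sequentially)
  have "norm (h ^ (2 ^ N)) * (1 / norm h) ^ (2 ^ N) = 1"
    using pos by (simp add: norm_power_self_adjoint[OF h] power_mult_distrib[symmetric])
  then show False
    using N[of "2 ^ N"] by (simp add: less_imp_le)
qed

section \<open>The positive cone and its order in terms of the norm\<close>

lemma positive_el_adj: "positive_el h \<Longrightarrow> adj h = (h :: 'a::cstar_algebra)"
  by (simp add: positive_el_def)

lemma positive_el_spectrum:
  assumes "positive_el (h :: 'a::cstar_algebra)" "z \<in> el_spectrum h"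
  obtains s where "z = complex_of_real s" "0 \<le> s" "s \<le> norm h"
  using assms cmod_le_norm_of_el_spectrum[OF assms(2)] by (auto simp: positive_el_def)

text \<open>The spectrum of \<open>of_real t - h\<close> lies in the interval from 0 to
  \<open>t\<close>. Together with \<open>positive_elI_norm\<close> this turns positivity into a norm
  inequality, which passes to sums by the triangle inequality.\<close>

lemma positive_el_norm_of_real_diff:
  assumes "positive_el (h :: 'a::cstar_algebra)" "norm h \<le> t"
  shows "norm (of_real t - h) \<le> t"
proof (rule norm_le_of_el_spectrum)
  show "adj (of_real t - h) = of_real t - h"
    using assms(1) by (simp add: adj_diff positive_el_adj)
  show "0 \<le> t"
    using assms(2) norm_ge_zero order_trans by blast
  fix z assume "z \<in> el_spectrum (of_real t - h)"
  then have "complex_of_real t - z \<in> el_spectrum h"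
    using el_spectrum_of_real_diff[of z "of_real t - h" t] by simp
  then obtain s where s: "complex_of_real t - z = complex_of_real s" "0 \<le> s" "s \<le> norm h"
    using positive_el_spectrum[OF assms(1)] by blast
  then have "z = complex_of_real (t - s)"
    by (simp add: algebra_simps)
  then have "cmod z = \<bar>t - s\<bar>"
    by (simp only: norm_of_real)
  then show "cmod z \<le> t"
    using s assms(2) by simp
qed

lemma positive_elI_norm:
  assumes "adj h = (h :: 'a::cstar_algebra)" "norm (of_real t - h) \<le> t"
  shows "positive_el h"
  unfolding positive_el_def
proof (intro conjI subsetI)
  fix z assume z: "z \<in> el_spectrum h"
  then have re: "z = complex_of_real (Re z)"
    using el_spectrum_self_adjoint_real[OF assms(1)] by (simp add: complex_eq_iff)
  have "cmod (complex_of_real t - z) \<le> t"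
    using cmod_le_norm_of_el_spectrum[OF el_spectrum_of_real_diff[OF z, of t]] assms(2) by linarith
  then have "\<bar>t - Re z\<bar> \<le> t"
    by (metis re norm_of_real of_real_diff)
  then have "0 \<le> Re z"
    by linarith
  then show "z \<in> complex_of_real ` {0..}"
    using re by (metis atLeast_iff image_eqI)
qed (rule assms(1))

lemma positive_el_add:
  assumes "positive_el (h :: 'a::cstar_algebra)" "positive_el k"
  shows "positive_el (h + k)"
proof (rule positive_elI_norm)
  show "adj (h + k) = h + k"
    using assms by (simp add: adj_add positive_el_adj)
  have "norm ((of_real (norm h) - h) + (of_real (norm k) - k)) \<le> norm h + norm k"
    by (rule norm_triangle_mono) (simp_all add: positive_el_norm_of_real_diff assms)
  then show "norm (of_real (norm h + norm k) - (h + k)) \<le> norm h + norm k"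
    by (simp add: algebra_simps)
qed

lemma positive_el_of_real: "0 \<le> t \<Longrightarrow> positive_el (of_real t :: 'a::cstar_algebra)"
  by (rule positive_elI_norm[where t = t]) simp_all

lemma positive_el_scaleR:
  assumes "positive_el (h :: 'a::cstar_algebra)" "0 \<le> r"
  shows "positive_el (scaleR r h)"
proof (rule positive_elI_norm)
  show "adj (scaleR r h) = scaleR r h"
    using assms by (simp add: adj_scaleR positive_el_adj)
  have "of_real (r * norm h) - scaleR r h = scaleR r (of_real (norm h) - h)"
    by (simp add: scaleR_diff_right of_real_def)
  then show "norm (of_real (r * norm h) - scaleR r h) \<le> r * norm h"
    using positive_el_norm_of_real_diff[OF assms(1) order_refl] assms(2) by (simp add: mult_left_mono)
qed

lemma positive_el_zero: "positive_el (0 :: 'a::cstar_algebra)"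
  using positive_el_of_real[of 0] by simp

lemma positive_el_sum:
  "(\<And>i. i \<in> I \<Longrightarrow> positive_el (f i)) \<Longrightarrow> positive_el (\<Sum>i\<in>I. f i :: 'a::cstar_algebra)"
  by (induction I rule: infinite_finite_induct) (simp_all add: positive_el_zero positive_el_add)

lemma positive_el_norm_minus:
  assumes "adj h = (h :: 'a::cstar_algebra)" "norm h \<le> t"
  shows "positive_el (of_real t - h)"
  by (rule positive_elI_norm[where t = t]) (use assms in \<open>simp_all add: adj_diff\<close>)

lemma positive_el_antisym:
  assumes "positive_el (h :: 'a::cstar_algebra)" "positive_el (- h)"
  shows "h = 0"
proof -
  have "norm h \<le> 0"
  proof (rule norm_le_of_el_spectrum)
    fix z assume z: "z \<in> el_spectrum h"
    obtain s where s: "z = complex_of_real s" "0 \<le> s"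
      using positive_el_spectrum[OF assms(1) z] by blast
    obtain r where r: "- z = complex_of_real r" "0 \<le> r"
      using positive_el_spectrum[OF assms(2) el_spectrum_minus[OF z]] by blast
    have "complex_of_real (- s) = complex_of_real r"
      using s(1) r(1) by simp
    then have "- s = r"
      by (simp only: of_real_eq_iff)
    then show "cmod z \<le> 0"
      using s r(2) by simp
  qed (simp_all add: positive_el_adj assms)
  then show ?thesis by simp
qed

lemma norm_le_of_order:
  assumes "positive_el (of_real t - h)" "positive_el (of_real t + (h :: 'a::cstar_algebra))" "0 \<le> t"
  shows "norm h \<le> t"
proof (rule norm_le_of_el_spectrum)
  have "adj (of_real t + h) = of_real t + h"
    using assms(2) by (rule positive_el_adj)
  then show h: "adj h = h"
    by (simp add: adj_add)
  fix z assume z: "z \<in> el_spectrum h"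
  then have re: "z = complex_of_real (Re z)"
    using el_spectrum_self_adjoint_real[OF h] by (simp add: complex_eq_iff)
  obtain s where s: "complex_of_real t - z = complex_of_real s" "0 \<le> s"
    using positive_el_spectrum[OF assms(1) el_spectrum_of_real_diff[OF z]] by blast
  have "z + complex_of_real t \<in> el_spectrum (of_real t + h)"
    using el_spectrum_shift[OF z, of "complex_of_real t"] by (simp add: cscale_of_real_one add.commute)
  then obtain r where r: "z + complex_of_real t = complex_of_real r" "0 \<le> r"
    using positive_el_spectrum[OF assms(2)] by blast
  have "t - Re z = s" "Re z + t = r"
    using arg_cong[OF s(1), of Re] arg_cong[OF r(1), of Re] by simp_all
  then have "\<bar>Re z\<bar> \<le> t"
    using s(2) r(2) by linarith
  then show "cmod z \<le> t"
    by (metis re norm_of_real)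
qed (rule assms(3))

lemma norm_mono_positive:
  assumes "positive_el (x :: 'a::cstar_algebra)" "positive_el (y - x)"
  shows "norm x \<le> norm y"
proof (rule norm_le_of_order)
  have "positive_el (x + (y - x))"
    using assms by (rule positive_el_add)
  then have "adj y = y"
    by (simp add: positive_el_adj)
  then have "positive_el ((of_real (norm y) - y) + (y - x))"
    by (intro positive_el_add positive_el_norm_minus assms) simp_all
  then show "positive_el (of_real (norm y) - x)"
    by simp
  show "positive_el (of_real (norm y) + x)"
    by (intro positive_el_add positive_el_of_real assms) simp
qed simp

section \<open>Squares and square roots\<close>

lemma positive_el_square:
  assumes "adj s = (s :: 'a::cstar_algebra)"
  shows "positive_el (s * s)"
  unfolding positive_el_def
proof (intro conjI subsetI)
  show "adj (s * s) = s * s"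
    by (simp add: adj_mult assms)
  fix z assume z: "z \<in> el_spectrum (s * s)"
  define w where "w = csqrt z"
  have zw: "z = w * w"
    by (simp add: w_def flip: power2_eq_square)
  \<comment> \<open>The element \<open>s * s - z\<close> factors as
    \<open>(s - w) * (s + w)\<close>. For non-real \<open>w\<close> both factors are invertible,
    because the spectrum of \<open>s\<close> is real.\<close>
  have "Im w = 0"
  proof (rule ccontr)
    assume "Im w \<noteq> 0"
    then have "w \<notin> el_spectrum s" "- w \<notin> el_spectrum s"
      using el_spectrum_self_adjoint_real[OF assms] by fastforce+
    then obtain b c where "inverse_pair (s - cscale w 1) b" "inverse_pair (s - cscale (- w) 1) c"
      by (auto simp: not_in_el_spectrum_iff)
    then have "inverse_pair ((s - cscale w 1) * (s - cscale (- w) 1)) (c * b)"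
      by (rule inverse_pair_mult)
    moreover have "(s - cscale w 1) * (s - cscale (- w) 1) = s * s - cscale z 1"
      by (simp add: zw cscale_minus_left left_diff_distrib distrib_left cscale_mult_right cscale_diff_right cscale_cscale)
    ultimately show False
      using z not_in_el_spectrum_iff by metis
  qed
  then have "z = complex_of_real (Re w * Re w)"
    by (simp add: zw complex_eq_iff)
  then show "z \<in> complex_of_real ` {0..}"
    by (metis atLeast_iff image_eqI zero_le_square)
qed

text \<open>
  The iteration \<open>y \<mapsto> (x + y\<^sup>2)/2\<close> converges to \<open>1 - sqrt (1 - x)\<close>. For \<open>\<parallel>x\<parallel> \<le> 1\<close> its increments are
  dominated by those of the scalar iteration with \<open>x = 1\<close>.
\<close>

primrec sqrt_iter :: "'b::real_algebra \<Rightarrow> nat \<Rightarrow> 'b" where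
  "sqrt_iter x 0 = 0"
| "sqrt_iter x (Suc n) = (1 / 2) *\<^sub>R (x + sqrt_iter x n * sqrt_iter x n)"

lemma sqrt_iter_one_bounds:
  "0 \<le> sqrt_iter (1::real) n" "sqrt_iter (1::real) n \<le> 1"
  "sqrt_iter (1::real) n \<le> sqrt_iter 1 (Suc n)"
proof -
  have *: "0 \<le> sqrt_iter (1::real) n \<and> sqrt_iter (1::real) n \<le> 1" for n
  proof (induction n)
    case (Suc n)
    then have "sqrt_iter (1::real) n * sqrt_iter 1 n \<le> 1"
      by (simp add: mult_le_one)
    then show ?case
      by simp
  qed simp
  then show "0 \<le> sqrt_iter (1::real) n" "sqrt_iter (1::real) n \<le> 1"
    by auto
  have "0 \<le> (1 - sqrt_iter (1::real) n) * (1 - sqrt_iter 1 n)"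
    by simp
  then show "sqrt_iter (1::real) n \<le> sqrt_iter 1 (Suc n)"
    by (simp add: algebra_simps)
qed

lemma norm_sqrt_iter_le:
  fixes x :: "'b::real_normed_algebra"
  assumes "norm x \<le> 1"
  shows "norm (sqrt_iter x n) \<le> sqrt_iter 1 n"
proof (induction n)
  case (Suc n)
  have "norm (sqrt_iter x n * sqrt_iter x n) \<le> norm (sqrt_iter x n) * norm (sqrt_iter x n)"
    by (rule norm_mult_ineq)
  also have "\<dots> \<le> sqrt_iter 1 n * sqrt_iter 1 n"
    using Suc by (intro mult_mono) (simp_all add: sqrt_iter_one_bounds)
  finally have "norm (x + sqrt_iter x n * sqrt_iter x n) \<le> 1 + sqrt_iter 1 n * sqrt_iter 1 n"
    using assms by (intro norm_triangle_mono)
  then show ?case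
    by simp
qed simp

lemma norm_sqrt_iter_diff_le:
  fixes x :: "'b::real_normed_algebra"
  assumes "norm x \<le> 1"
  shows "norm (sqrt_iter x (Suc n) - sqrt_iter x n) \<le> sqrt_iter 1 (Suc n) - sqrt_iter 1 n"
proof (induction n)
  case 0
  then show ?case
    using assms by simp
next
  case (Suc n)
  define p q where "p = sqrt_iter x (Suc n)" and "q = sqrt_iter x n"
  define s t where "s = sqrt_iter (1::real) (Suc n)" and "t = sqrt_iter (1::real) n"
  have pq: "norm (p - q) \<le> s - t" "norm p \<le> s" "norm q \<le> t"
    using Suc norm_sqrt_iter_le[OF assms] unfolding p_def q_def s_def t_def by blast+
  \<comment> \<open>This splitting needs no commutation. Bounding its terms separately gives exactly
    \<open>s * s - t * t\<close>, twice the next scalar increment.\<close>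
  have "p * p - q * q = (p - q) * p + q * (p - q)"
    by (simp add: algebra_simps)
  then have "norm (p * p - q * q) \<le> norm (p - q) * norm p + norm q * norm (p - q)"
    using norm_triangle_mono[OF norm_mult_ineq norm_mult_ineq] by metis
  also have "\<dots> \<le> (s - t) * s + t * (s - t)"
    using pq sqrt_iter_one_bounds(3)[of n, folded s_def t_def]
    by (intro add_mono mult_mono) (auto intro: order_trans[OF norm_ge_zero])
  also have "\<dots> = s * s - t * t"
    by (simp add: algebra_simps)
  finally have le: "norm (p * p - q * q) \<le> s * s - t * t" .
  have "sqrt_iter x (Suc (Suc n)) - sqrt_iter x (Suc n) = (1 / 2) *\<^sub>R (p * p - q * q)"
    unfolding p_def q_def sqrt_iter.simps(2)[of x "Suc n"]
    by (subst (3) sqrt_iter.simps(2)) (simp only: scaleR_diff_right[symmetric] add_diff_cancel_left)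
  moreover have "sqrt_iter 1 (Suc (Suc n)) - sqrt_iter 1 (Suc n) = (1 / 2) * (s * s - t * t)"
    unfolding s_def t_def sqrt_iter.simps(2)[of "1::real" "Suc n"]
    by (subst (3) sqrt_iter.simps(2)) (simp only: real_scaleR_def right_diff_distrib[symmetric] add_diff_cancel_left)
  ultimately show ?case
    using le by simp
qed

lemma convergent_sqrt_iter:
  fixes x :: "'b::{real_normed_algebra,banach}"
  assumes "norm x \<le> 1"
  shows "convergent (sqrt_iter x)"
proof -
  have "incseq (sqrt_iter (1::real))"
    by (intro incseq_SucI sqrt_iter_one_bounds(3))
  then obtain l where "sqrt_iter (1::real) \<longlonglongrightarrow> l"
    using incseq_convergent sqrt_iter_one_bounds(2) by metis
  then have "summable (\<lambda>n. sqrt_iter (1::real) (Suc n) - sqrt_iter 1 n)"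
    by (rule telescope_summable)
  then have "summable (\<lambda>n. sqrt_iter x (Suc n) - sqrt_iter x n)"
    by (rule summable_comparison_test'[where N = 0]) (rule norm_sqrt_iter_diff_le[OF assms])
  then have "convergent (\<lambda>n. \<Sum>k<n. sqrt_iter x (Suc k) - sqrt_iter x k)"
    by (simp only: summable_iff_convergent)
  then show ?thesis
    by (simp only: sum_lessThan_telescope sqrt_iter.simps(1) diff_zero)
qed

lemma adj_sqrt_iter:
  "adj x = x \<Longrightarrow> adj (sqrt_iter x n) = (sqrt_iter x n :: 'a::cstar_algebra)"
  by (induction n) (simp_all add: adj_scaleR adj_add adj_mult)

lemma sqrt_iter_commute: "c * x = x * c \<Longrightarrow> c * sqrt_iter x n = sqrt_iter x n * c"
proof (induction n)
  case (Suc n)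
  then have "c * (sqrt_iter x n * sqrt_iter x n) = sqrt_iter x n * sqrt_iter x n * c"
    by (metis mult.assoc)
  then show ?case
    using Suc by (simp add: distrib_left distrib_right)
qed simp

text \<open>The limit satisfies \<open>y = (x + y * y) / 2\<close>, which rearranges to
  \<open>(1 - y) * (1 - y) = 1 - x\<close>. Self-adjointness and commutation with whatever commutes
  with \<open>x\<close> hold for each iterate and pass to the limit.\<close>

lemma sqrt_fixpoint:
  fixes x :: "'a::cstar_algebra"
  assumes x: "adj x = x" "norm x \<le> 1"
  obtains y where "adj y = y" "norm y \<le> 1" "(1 - y) * (1 - y) = 1 - x"
    "\<And>c. c * x = x * c \<Longrightarrow> c * y = y * c"
proof -
  obtain y where y: "sqrt_iter x \<longlonglongrightarrow> y"
    using convergent_sqrt_iter[OF x(2)] by (auto simp: convergent_def)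
  have "(\<lambda>n. adj (sqrt_iter x n)) \<longlonglongrightarrow> adj y"
    by (rule bounded_linear.tendsto[OF bounded_linear_adj y])
  then have "adj y = y"
    using y by (simp add: adj_sqrt_iter[OF x(1)] LIMSEQ_unique)
  moreover have "norm (sqrt_iter x n) \<le> 1" for n
    using norm_sqrt_iter_le[OF x(2), of n] sqrt_iter_one_bounds(2)[of n] by linarith
  then have "norm y \<le> 1"
    by (intro LIMSEQ_le_const2[OF tendsto_norm[OF y]]) auto
  moreover have "(1 - y) * (1 - y) = 1 - x"
  proof -
    have "(\<lambda>n. sqrt_iter x (Suc n)) \<longlonglongrightarrow> (1 / 2) *\<^sub>R (x + y * y)"
      unfolding sqrt_iter.simps by (intro tendsto_intros y)
    then have "y = (1 / 2) *\<^sub>R (x + y * y)"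
      using LIMSEQ_Suc[OF y] LIMSEQ_unique by blast
    then have "y + y = x + y * y"
      by (metis scaleR_half_double scaleR_add_right)
    then show ?thesis
      by (simp add: algebra_simps)
  qed
  moreover have "c * y = y * c" if "c * x = x * c" for c
  proof (rule LIMSEQ_unique)
    show "(\<lambda>n. c * sqrt_iter x n) \<longlonglongrightarrow> c * y"
      by (intro tendsto_intros y)
    show "(\<lambda>n. c * sqrt_iter x n) \<longlonglongrightarrow> y * c"
      unfolding sqrt_iter_commute[OF that] by (intro tendsto_intros y)
  qed
  ultimately show ?thesis
    using that by blast
qed

text \<open>Scaling by \<open>t = norm h\<close> makes \<open>x = 1 - (1 / t) *\<^sub>R h\<close> a
  contraction, by the norm description of positivity. The root is
  \<open>sqrt t *\<^sub>R (1 - y)\<close>, positive because \<open>norm y <= 1\<close>.\<close>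

lemma positive_el_sqrt:
  assumes "positive_el (h :: 'a::cstar_algebra)"
  obtains k where "positive_el k" "k * k = h" "\<And>c. c * h = h * c \<Longrightarrow> c * k = k * c"
proof (cases "h = 0")
  case True
  then show ?thesis
    using that[of 0] by (simp add: positive_el_zero)
next
  case False
  define t where "t = norm h"
  have t: "t > 0"
    using False by (simp add: t_def)
  define x where "x = 1 - (1 / t) *\<^sub>R h"
  have hx: "h = t *\<^sub>R (1 - x)"
    using t by (simp add: x_def)
  have adjx: "adj x = x"
    by (simp add: x_def adj_diff adj_scaleR positive_el_adj[OF assms])
  have "norm (of_real 1 - (1 / t) *\<^sub>R h) \<le> 1"
  proof (rule positive_el_norm_of_real_diff)
    show "positive_el ((1 / t) *\<^sub>R h)"
      using t by (intro positive_el_scaleR assms) simp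
    show "norm ((1 / t) *\<^sub>R h) \<le> 1"
      using t by (simp add: t_def)
  qed
  then have "norm x \<le> 1"
    by (simp add: x_def)
  from sqrt_fixpoint[OF adjx this] obtain y where y: "adj y = y" "norm y \<le> 1" "(1 - y) * (1 - y) = 1 - x"
    "\<And>c. c * x = x * c \<Longrightarrow> c * y = y * c"
    by blast
  show ?thesis
  proof (rule that)
    have "positive_el (1 - y)"
      by (rule positive_elI_norm[where t = 1]) (use y in \<open>simp_all add: adj_diff\<close>)
    then show "positive_el (sqrt t *\<^sub>R (1 - y))"
      using t by (intro positive_el_scaleR) simp_all
    show "(sqrt t *\<^sub>R (1 - y)) * (sqrt t *\<^sub>R (1 - y)) = h"
      using t y(3) hx by simp
    fix c assume "c * h = h * c"
    then have "c * x = x * c"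
      by (simp add: x_def left_diff_distrib right_diff_distrib)
    then show "c * (sqrt t *\<^sub>R (1 - y)) = (sqrt t *\<^sub>R (1 - y)) * c"
      using y(4) by (simp add: left_diff_distrib right_diff_distrib)
  qed
qed

section \<open>Positivity of \<open>adj b * b\<close>\<close>

text \<open>The formula is read off the formal series: \<open>1 + ba + baba + ...\<close> equals
  \<open>1 + b (1 + ab + ...) a\<close>.\<close>

lemma inverse_pair_one_minus_mult_swap:
  fixes a b :: "'b::ring_1"
  assumes "inverse_pair (1 - a * b) c"
  shows "inverse_pair (1 - b * a) (1 + b * c * a)"
proof -
  have c: "c = 1 + a * b * c" "c = 1 + c * a * b"
    using assms by (simp_all add: inverse_pair_def algebra_simps)
  have "b * (1 + a * b * c) * a = b * a + b * a * b * c * a"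
    by (simp add: algebra_simps)
  then have 1: "b * c * a = b * a + b * a * b * c * a"
    using arg_cong[OF c(1), of "\<lambda>x. b * x * a"] by (rule trans[rotated])
  have "b * (1 + c * a * b) * a = b * a + b * c * a * b * a"
    by (simp add: algebra_simps)
  then have 2: "b * c * a = b * a + b * c * a * b * a"
    using arg_cong[OF c(2), of "\<lambda>x. b * x * a"] by (rule trans[rotated])
  have "(1 - b * a) * (1 + b * c * a) = 1 + b * c * a - (b * a + b * a * b * c * a)"
    by (simp add: algebra_simps)
  moreover have "(1 + b * c * a) * (1 - b * a) = 1 + b * c * a - (b * a + b * c * a * b * a)"
    by (simp add: algebra_simps)
  ultimately show ?thesis
    unfolding inverse_pair_def 1[symmetric] 2[symmetric] by simp
qed

lemma el_spectrum_mult_swap: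
  assumes "z \<in> el_spectrum (a * b :: 'a::cstar_algebra)" "z \<noteq> 0"
  shows "z \<in> el_spectrum (b * a)"
proof (rule ccontr)
  assume "z \<notin> el_spectrum (b * a)"
  then obtain c where "inverse_pair (b * a - cscale z 1) c"
    by (auto simp: not_in_el_spectrum_iff)
  from inverse_pair_cscale[OF this, of "- 1 / z"]
  have "\<exists>c. inverse_pair (1 - b * cscale (1 / z) a) c"
    using assms(2)
    by (auto simp: cscale_diff_right cscale_cscale cscale_minus_left cscale_one cscale_mult_right)
  then obtain d where "inverse_pair (1 - cscale (1 / z) a * b) d"
    using inverse_pair_one_minus_mult_swap by blast
  from inverse_pair_cscale[OF this, of "- z"]
  have "\<exists>c. inverse_pair (a * b - cscale z 1) c"
    using assms(2)
    by (auto simp: cscale_diff_right cscale_cscale cscale_minus_left cscale_one cscale_mult_left)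
  then show False
    using assms(1) not_in_el_spectrum_iff by blast
qed

lemma positive_el_minus_mult_swap:
  assumes "positive_el (- (adj c * c :: 'a::cstar_algebra))"
  shows "positive_el (- (c * adj c))"
  unfolding positive_el_def
proof (intro conjI subsetI)
  show "adj (- (c * adj c)) = - (c * adj c)"
    by (simp add: adj_mult adj_adj)
  fix z assume z: "z \<in> el_spectrum (- (c * adj c))"
  show "z \<in> complex_of_real ` {0..}"
  proof (cases "z = 0")
    case True
    then show ?thesis
      by (auto intro: image_eqI[of _ _ 0])
  next
    case False
    have "- z \<in> el_spectrum (c * adj c)"
      using el_spectrum_minus[OF z] by simp
    then have "- z \<in> el_spectrum (adj c * c)"
      by (rule el_spectrum_mult_swap) (simp add: False)
    then have "z \<in> el_spectrum (- (adj c * c))"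
      using el_spectrum_minus by fastforce
    then show ?thesis
      using assms by (auto simp: positive_el_def)
  qed
qed

text \<open>\<open>c\<^sup>*c + cc\<^sup>* = 2 (u\<^sup>2 + v\<^sup>2)\<close> for the real and imaginary parts \<open>u\<close>, \<open>v\<close> of \<open>c\<close>.\<close>

lemma adj_mult_nonpositive_imp_zero:
  assumes "positive_el (- (adj c * c :: 'a::cstar_algebra))"
  shows "c = 0"
proof -
  \<comment> \<open>These are twice the real part and minus twice the imaginary part of
    \<open>c\<close>, so here \<open>u * u + v * v\<close> is \<open>2\<close> times
    \<open>adj c * c + c * adj c\<close>.\<close>
  define u v where "u = c + adj c" and "v = cscale \<i> (c - adj c)"
  have "adj u = u" "adj v = v"
    by (simp_all add: u_def v_def adj_add adj_diff adj_adj adj_cscale add.commute cscale_minus_left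
        cscale_diff_right)
  then have "positive_el ((1 / 2) *\<^sub>R (u * u + v * v) + - (c * adj c))"
    by (intro positive_el_add positive_el_scaleR positive_el_square positive_el_minus_mult_swap assms) simp_all
  moreover have "u * u + v * v = 2 *\<^sub>R (adj c * c + c * adj c)"
  proof -
    have "v * v = - ((c - adj c) * (c - adj c))"
      by (simp add: v_def cscale_mult_left cscale_mult_right cscale_cscale cscale_minus_left cscale_one)
    then show ?thesis
      by (simp add: u_def algebra_simps scaleR_2)
  qed
  ultimately have "positive_el (adj c * c)"
    by simp
  then have "adj c * c = 0"
    using assms positive_el_antisym by blast
  then show ?thesis
    by (rule adj_mult_eq_zero)
qed

text \<open>
  With \<open>h = b\<^sup>*b\<close>, \<open>m = \<bar>h\<bar>\<close>, \<open>g = m - h\<close> one has \<open>hg = -mg\<close>, so \<open>(bg)\<^sup>*(bg) = ghg = -gmg \<le> 0\<close>,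
  which forces \<open>bg = 0\<close> and then \<open>g\<^sup>2 = 0\<close>. Using \<open>g\<close> in place of the negative part of \<open>h\<close> avoids
  the functional calculus.
\<close>

theorem positive_el_adj_mult: "positive_el (adj b * b :: 'a::cstar_algebra)"
proof -
  define h where "h = adj b * b"
  have h: "adj h = h"
    by (simp add: h_def adj_mult adj_adj)
  from positive_el_sqrt[OF positive_el_square[OF h]] obtain m
    where m: "positive_el m" "m * m = h * h" "\<And>c. c * (h * h) = h * h * c \<Longrightarrow> c * m = m * c"
    by blast
  \<comment> \<open>The root \<open>k\<close> of \<open>m\<close> turns \<open>g * m * g\<close>
    into the square of \<open>g * k\<close>, which is self-adjoint because \<open>g\<close> and
    \<open>k\<close> commute.\<close>
  from positive_el_sqrt[OF m(1)] obtain k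
    where k: "positive_el k" "k * k = m" "\<And>c. c * m = m * c \<Longrightarrow> c * k = k * c"
    by blast
  have hm: "h * m = m * h"
    by (rule m(3)) (simp add: mult.assoc)
  define g where "g = m - h"
  have g: "adj g = g"
    by (simp add: g_def adj_diff h positive_el_adj[OF m(1)])
  have gk: "g * k = k * g"
    by (rule k(3)) (simp add: g_def left_diff_distrib right_diff_distrib hm)
  have hg: "h * g = - (m * g)"
    by (simp add: g_def right_diff_distrib hm m(2))
  have adj_gk: "adj (g * k) = g * k"
    by (simp add: adj_mult g positive_el_adj[OF k(1)] gk)
  have "adj (b * g) * (b * g) = g * (h * g)"
    by (simp add: adj_mult g h_def mult.assoc)
  also have "\<dots> = - (g * k * (k * g))"
    by (simp add: hg k(2)[symmetric] mult.assoc)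
  finally have "- (adj (b * g) * (b * g)) = (g * k) * (g * k)"
    by (simp add: gk)
  then have "positive_el (- (adj (b * g) * (b * g)))"
    using positive_el_square[OF adj_gk] by simp
  then have "b * g = 0"
    by (rule adj_mult_nonpositive_imp_zero)
  then have "h * g = 0"
    by (simp add: h_def mult.assoc)
  \<comment> \<open>Also \<open>m * g = - (h * g) = 0\<close>, and \<open>g * g\<close> is
    \<open>(m - h) * g\<close>.\<close>
  then have "adj g * g = 0"
    using hg g by (simp add: g_def left_diff_distrib)
  then have "g = 0"
    by (rule adj_mult_eq_zero)
  then show ?thesis
    using m(1) by (simp add: g_def h_def)
qed

lemma positive_el_conj:
  assumes "positive_el (q :: 'a::cstar_algebra)"
  shows "positive_el (adj c * q * c)"
proof -
  obtain k where k: "positive_el k" "k * k = q"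
    using positive_el_sqrt[OF assms] by blast
  have "adj c * q * c = adj (k * c) * (k * c)"
    by (simp add: adj_mult positive_el_adj[OF k(1)] k(2)[symmetric] mult.assoc)
  then show ?thesis
    by (simp add: positive_el_adj_mult)
qed

section \<open>The norm of a positive map\<close>

lemma clinear_map_simps:
  assumes "clinear_map f"
  shows "f (x + y) = f x + f y" "f (cscale c x) = cscale c (f x)" "f 0 = 0"
    "f (- x) = - f x" "f (x - y) = f x - f y" "f (scaleR r x) = scaleR r (f x)"
proof -
  show add: "f (x + y) = f x + f y" and cscale: "f (cscale c x) = cscale c (f x)" for x y c
    using assms by (auto simp: clinear_map_def)
  show "f 0 = 0"
    using cscale[of 0 0] by simp
  show minus: "f (- x) = - f x" for x
    using cscale[of "- 1" x] by (simp add: cscale_minus_left cscale_one)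
  show "f (x - y) = f x - f y"
    using add[of x "- y"] by (simp add: minus)
  show "f (scaleR r x) = scaleR r (f x)"
    by (simp add: scaleR_cscale cscale)
qed

lemma clinear_map_sum:
  assumes "clinear_map f"
  shows "f (\<Sum>i\<in>I. g i) = (\<Sum>i\<in>I. f (g i))"
  by (induction I rule: infinite_finite_induct) (simp_all add: clinear_map_simps[OF assms])

lemma positive_map_one: "positive_map \<psi> \<Longrightarrow> positive_el (\<psi> (1 :: 'a::cstar_algebra))"
  using positive_el_of_real[of 1, where 'a = 'a] by (simp add: positive_map_def)

text \<open>Both \<open>h\<close> and \<open>- h\<close> lie below \<open>norm h\<close>; applying
  \<open>\<psi>\<close> and then \<open>\<psi> 1 <= norm (\<psi> 1)\<close> confines
  \<open>\<psi> h\<close> from both sides.\<close>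

lemma positive_map_norm_self_adjoint:
  assumes "positive_map \<psi>" "adj h = (h :: 'a::cstar_algebra)"
  shows "norm (\<psi> h) \<le> norm h * norm (\<psi> 1)"
proof (rule norm_le_of_order)
  have lin: "clinear_map \<psi>" and pos: "\<And>x. positive_el x \<Longrightarrow> positive_el (\<psi> x)"
    using assms(1) by (auto simp: positive_map_def)
  have psi1: "positive_el (\<psi> 1)"
    using assms(1) by (rule positive_map_one)
  have *: "positive_el (of_real (norm h * norm (\<psi> 1)) - \<psi> k)" if "adj k = k" "norm k = norm h" for k
  proof -
    have "positive_el (norm h *\<^sub>R (of_real (norm (\<psi> 1)) - \<psi> 1) + \<psi> (of_real (norm h) - k))"
      by (intro positive_el_add positive_el_scaleR positive_el_norm_minus pos)
        (simp_all add: that positive_el_adj[OF psi1])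
    then show ?thesis
      by (simp add: of_real_def scaleR_diff_right clinear_map_simps[OF lin])
  qed
  show "positive_el (of_real (norm h * norm (\<psi> 1)) - \<psi> h)"
    using assms(2) by (intro *) simp_all
  show "positive_el (of_real (norm h * norm (\<psi> 1)) + \<psi> h)"
    using *[of "- h"] assms(2) by (simp add: clinear_map_simps[OF lin])
qed simp

text \<open>Splitting \<open>x\<close> into real and imaginary parts costs a factor 2. The resulting
  continuity is what the limit in \<open>positive_map_norm_le\<close> relies on to reach the sharp
  constant.\<close>

lemma positive_map_bounded_op:
  assumes "positive_map (\<psi> :: 'a::cstar_algebra \<Rightarrow> 'a)"
  shows "bounded_op \<psi>"
proof -
  have lin: "clinear_map \<psi>"
    using assms by (simp add: positive_map_def)
  have "norm (\<psi> x) \<le> (2 * norm (\<psi> 1)) * norm x" for x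
  proof -
    define u v where "u = (1 / 2) *\<^sub>R (x + adj x)" and "v = cscale (- \<i> / 2) (x - adj x)"
    have adj_uv: "adj u = u" "adj v = v"
      by (simp_all add: u_def v_def adj_add adj_diff adj_adj adj_cscale adj_scaleR add.commute
          cscale_minus_left cscale_diff_right)
    have norm_uv: "norm u \<le> norm x" "norm v \<le> norm x"
      using norm_triangle_ineq[of x "adj x"] norm_triangle_ineq4[of x "adj x"]
      by (simp_all add: u_def v_def norm_cscale norm_divide)
    have "cscale \<i> v = (1 / 2) *\<^sub>R (x - adj x)"
      by (simp add: v_def cscale_cscale scaleR_cscale)
    then have "u + cscale \<i> v = (1 / 2) *\<^sub>R (x + x)"
      by (simp add: u_def scaleR_add_right[symmetric])
    then have "x = u + cscale \<i> v"
      by simp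
    then have "norm (\<psi> x) = norm (\<psi> u + cscale \<i> (\<psi> v))"
      by (simp add: clinear_map_simps[OF lin])
    also have "\<dots> \<le> norm (\<psi> u) + norm (\<psi> v)"
      using norm_triangle_ineq[of "\<psi> u" "cscale \<i> (\<psi> v)"] by (simp add: norm_cscale)
    also have "\<dots> \<le> norm u * norm (\<psi> 1) + norm v * norm (\<psi> 1)"
      using positive_map_norm_self_adjoint[OF assms] adj_uv by (intro add_mono) auto
    also have "\<dots> \<le> norm x * norm (\<psi> 1) + norm x * norm (\<psi> 1)"
      using norm_uv by (intro add_mono mult_right_mono) auto
    finally show ?thesis
      by (simp add: algebra_simps)
  qed
  then show ?thesis
    using lin unfolding bounded_op_def by blast
qed

lemma bounded_op_bounded_linear:
  assumes "bounded_op (f :: 'a::cstar_algebra \<Rightarrow> 'a)"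
  shows "bounded_linear f"
proof -
  obtain K where lin: "clinear_map f" and K: "\<And>x. norm (f x) \<le> K * norm x"
    using assms by (auto simp: bounded_op_def)
  show ?thesis
    by (rule bounded_linear_intro[where K = K])
      (simp_all add: clinear_map_simps[OF lin] K mult.commute)
qed

text \<open>
  The Cauchy--Schwarz inequality for the column \<open>(q\<^sub>i\<^sup>1\<^sup>/\<^sup>2)\<close>: add up
  \<open>(c - \<lambda>\<^sub>i)\<^sup>* q\<^sub>i (c - \<lambda>\<^sub>i) \<ge> 0\<close> for \<open>c = S/p\<close>, where \<open>S = \<Sum> \<lambda>\<^sub>i q\<^sub>i\<close> and \<open>p \<ge> \<parallel>\<Sum> q\<^sub>i\<parallel>\<close>.
\<close>

lemma norm_unimodular_combination_le:
  fixes q :: "'i \<Rightarrow> 'a::cstar_algebra"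
  assumes pos: "\<And>i. i \<in> I \<Longrightarrow> positive_el (q i)" and unim: "\<And>i. i \<in> I \<Longrightarrow> cmod (l i) = 1"
  shows "norm (\<Sum>i\<in>I. cscale (l i) (q i)) \<le> norm (\<Sum>i\<in>I. q i)"
proof (rule field_le_epsilon)
  fix e :: real assume e: "e > 0"
  \<comment> \<open>The slack \<open>e\<close> keeps \<open>p\<close> positive even when
    \<open>P = 0\<close>, so that \<open>S\<close> can be divided by \<open>p\<close>.\<close>
  define S P p where "S = (\<Sum>i\<in>I. cscale (l i) (q i))" and "P = (\<Sum>i\<in>I. q i)" and "p = norm P + e"
  have p: "p > 0" "norm P \<le> p"
    using e by (simp_all add: p_def add_nonneg_pos)
  have P: "positive_el P"
    unfolding P_def by (rule positive_el_sum) (rule pos)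
  have adjS: "adj S = (\<Sum>i\<in>I. cscale (cnj (l i)) (q i))"
    unfolding S_def adj_sum by (intro sum.cong) (simp_all add: adj_cscale positive_el_adj[OF pos])
  define c where "c = (1 / p) *\<^sub>R S"
  have "positive_el (\<Sum>i\<in>I. adj (c - cscale (l i) 1) * q i * (c - cscale (l i) 1))"
    by (intro positive_el_sum positive_el_conj pos)
  also have "(\<Sum>i\<in>I. adj (c - cscale (l i) 1) * q i * (c - cscale (l i) 1))
      = (\<Sum>i\<in>I. adj c * q i * c - adj c * cscale (l i) (q i) - cscale (cnj (l i)) (q i) * c + q i)"
  proof (rule sum.cong)
    fix i assume "i \<in> I"
    then have "l i * cnj (l i) = 1"
      using unim by (simp add: complex_norm_square[symmetric])
    then show "adj (c - cscale (l i) 1) * q i * (c - cscale (l i) 1)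
        = adj c * q i * c - adj c * cscale (l i) (q i) - cscale (cnj (l i)) (q i) * c + q i"
      by (simp add: adj_diff adj_cscale left_diff_distrib right_diff_distrib cscale_mult_left
          cscale_mult_right cscale_cscale cscale_one cscale_diff_right)
  qed simp
  also have "\<dots> = adj c * P * c - adj c * S - adj S * c + P"
    unfolding adjS unfolding S_def P_def
    by (simp add: sum_subtractf sum.distrib sum_distrib_left sum_distrib_right)
  finally have "positive_el (adj c * P * c - adj c * S - adj S * c + P)" .
  \<comment> \<open>Adding this term replaces \<open>P\<close> by \<open>p\<close> in the quadratic
    part; with \<open>c = S / p\<close> all that remains is
    \<open>P - (1 / p) *\<^sub>R (adj S * S)\<close>.\<close>
  moreover have "positive_el (adj c * (of_real p - P) * c)"
    using p(2) P by (intro positive_el_conj positive_el_norm_minus positive_el_adj)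
  ultimately have
    "positive_el ((adj c * P * c - adj c * S - adj S * c + P) + adj c * (of_real p - P) * c)"
    by (rule positive_el_add)
  moreover have "(adj c * P * c - adj c * S - adj S * c + P) + adj c * (of_real p - P) * c
      = P - (1 / p) *\<^sub>R (adj S * S)"
    using p(1) by (simp add: c_def adj_scaleR of_real_def left_diff_distrib right_diff_distrib
        scaleR_diff_right)
  ultimately have "positive_el (P - (1 / p) *\<^sub>R (adj S * S))"
    by simp
  then have "norm ((1 / p) *\<^sub>R (adj S * S)) \<le> norm P"
    using p(1) by (intro norm_mono_positive positive_el_scaleR positive_el_adj_mult) simp_all
  then have "(norm S)\<^sup>2 / p \<le> p"
    using p by (simp add: cstar_identity)
  then have "(norm S)\<^sup>2 \<le> p\<^sup>2"
    using p(1) by (simp add: pos_divide_le_eq power2_eq_square)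
  then have "norm S \<le> p"
    by (rule power2_le_imp_le) (use p(1) in simp)
  then show "norm (\<Sum>i\<in>I. cscale (l i) (q i)) \<le> norm (\<Sum>i\<in>I. q i) + e"
    by (simp only: S_def P_def p_def)
qed

text \<open>The kernel equals \<open>adj g * (1 - adj y * y) * g\<close>, and
  \<open>1 - adj y * y\<close> is positive for a contraction \<open>y\<close>.\<close>

lemma positive_el_poisson_kernel:
  assumes "norm (y :: 'a::cstar_algebra) \<le> 1" "inverse_pair (1 - y) g"
  shows "positive_el (g + adj g - 1)"
proof -
  have "norm (adj y * y) \<le> 1"
    using assms(1) by (simp add: cstar_identity power_le_one)
  then have "positive_el (of_real 1 - adj y * y)"
    by (intro positive_el_norm_minus) (simp_all add: adj_mult adj_adj)
  then have "positive_el (adj g * (1 - adj y * y) * g)"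
    by (intro positive_el_conj) simp
  also have "1 - adj y * y = (1 - adj y) + (1 - y) - (1 - adj y) * (1 - y)"
    by (simp add: algebra_simps)
  also have "adj g * ((1 - adj y) + (1 - y) - (1 - adj y) * (1 - y)) * g
      = (adj g * (1 - adj y)) * g + adj g * ((1 - y) * g) - (adj g * (1 - adj y)) * ((1 - y) * g)"
    by (simp only: distrib_left distrib_right left_diff_distrib right_diff_distrib mult.assoc)
  also have "\<dots> = g + adj g - 1"
    using assms(2) inverse_pair_adj[OF assms(2)] by (simp add: inverse_pair_def adj_diff)
  finally show ?thesis .
qed

text \<open>
  The two arguments of \<open>\<psi>\<close> are discrete Fourier coefficients of the
  Poisson kernel of \<open>x\<close>, and tend to \<open>x\<close> and \<open>1\<close> as \<open>n\<close> grows.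
\<close>

lemma positive_map_poisson_average:
  fixes x :: "'a::cstar_algebra"
  assumes psi: "positive_map \<psi>" and x: "norm x < 1" and n: "n \<ge> 2"
    and Q: "inverse_pair (1 - x ^ n) Q"
  shows "norm (\<psi> (Q * x + adj (Q * x ^ (n - 1)))) \<le> norm (\<psi> (Q + adj Q - 1))"
proof -
  have lin: "clinear_map \<psi>" and pos: "\<And>x. positive_el x \<Longrightarrow> positive_el (\<psi> x)"
    using psi by (auto simp: positive_map_def)
  have n0: "n > 0"
    using n by simp
  define w where "w = cis (2 * pi / real n)"
  have w: "cmod (w ^ j) = 1" for j
    by (simp add: w_def norm_power)
  have norm_wx: "norm (cscale (w ^ j) 1 * x) = norm x" for j
    by (simp add: norm_cscale w)
  then have "\<exists>b. inverse_pair (1 - cscale (w ^ j) 1 * x) b" for j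
    using x by (intro neumann_inverse) simp
  then obtain G where G: "\<And>j. inverse_pair (1 - cscale (w ^ j) 1 * x) (G j)"
    by metis
  have Qinv: "y = Q * z" if "(1 - x ^ n) * y = z" for y z
    using Q that by (metis inverse_pair_def mult.assoc mult.left_neutral)
  have avg: "(\<Sum>j<n. cscale (w ^ (j * e)) (G j)) = real n *\<^sub>R (Q * x ^ ((n - e) mod n))" if "e < n" for e
  proof -
    have "(1 - x ^ n) * (\<Sum>j<n. cscale (w ^ (j * e)) (G j)) = of_nat n * x ^ ((n - e) mod n)"
      using cscale.resolvent_averages(1)[OF n0 that, of x G] G by (simp add: w_def)
    then have "(\<Sum>j<n. cscale (w ^ (j * e)) (G j)) = Q * (of_nat n * x ^ ((n - e) mod n))"
      by (rule Qinv)
    moreover have "of_nat n = (real n *\<^sub>R 1 :: 'a)"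
      by (simp add: of_real_def[symmetric])
    ultimately show ?thesis
      by simp
  qed
  define p where "p j = G j + adj (G j) - 1" for j
  have p: "positive_el (p j)" for j
    unfolding p_def using x norm_wx by (intro positive_el_poisson_kernel[OF _ G]) simp
  have sumG: "(\<Sum>j<n. G j) = real n *\<^sub>R Q"
    using avg[of 0] n0 by (simp add: cscale_one)
  have sum_p: "(\<Sum>j<n. p j) = real n *\<^sub>R (Q + adj Q - 1)"
    by (simp add: p_def sum_subtractf sum.distrib adj_sum[symmetric] sumG adj_scaleR
        scaleR_diff_right scaleR_add_right of_real_def[symmetric])
  \<comment> \<open>Conjugate weights are the exponent \<open>e = n - 1\<close>, which extracts
    \<open>x\<close> from the \<open>G j\<close>; on the adjoints they act as \<open>e = 1\<close>
    and extract \<open>x ^ (n - 1)\<close>. The constant term of the kernel averages to 0 because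
    \<open>n >= 2\<close>.\<close>
  have cnj_w: "cnj (w ^ j) = w ^ (j * (n - 1))" for j
  proof -
    have "w ^ n = 1"
      unfolding w_def using n0 by (subst Complex.DeMoivre) simp
    then have "w ^ (j * (n - 1)) * w ^ j = 1"
      using n0 by (metis mult.commute power_add power_mult power_one mult_Suc_right Suc_diff_1 add.commute)
    moreover have "cnj (w ^ j) * w ^ j = 1"
      using w[of j] by (metis complex_norm_square mult.commute of_real_1 power_one)
    ultimately show ?thesis
      by (metis mult_right_cancel mult_zero_right zero_neq_one)
  qed
  have "(\<Sum>j<n. cscale (cnj (w ^ j)) (G j)) = real n *\<^sub>R (Q * x)"
    unfolding cnj_w using avg[of "n - 1"] n by (simp add: mod_less)
  moreover have "(\<Sum>j<n. cscale (cnj (w ^ j)) (adj (G j))) = adj (\<Sum>j<n. cscale (w ^ (j * 1)) (G j))"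
    by (simp only: adj_sum adj_cscale mult_1_right)
  then have "(\<Sum>j<n. cscale (cnj (w ^ j)) (adj (G j))) = real n *\<^sub>R adj (Q * x ^ (n - 1))"
    using avg[of 1] n by (simp add: adj_scaleR mod_less)
  moreover have "(\<Sum>j<n. cscale (cnj (w ^ j)) (1 :: 'a)) = 0"
  proof -
    have "\<not> n dvd 1"
      using n by simp
    then have "(\<Sum>j<n. w ^ (j * 1)) = 0"
      unfolding w_def sum_powers_root_of_unity[OF n0] by simp
    then have "cnj (\<Sum>j<n. w ^ j) = 0"
      by simp
    then have "(\<Sum>j<n. cnj (w ^ j)) = 0"
      by (simp only: cnj_sum)
    then show ?thesis
      by (metis cscale.iota_sum cscale.iota_zero)
  qed
  ultimately have sum_wp: "(\<Sum>j<n. cscale (cnj (w ^ j)) (p j)) = real n *\<^sub>R (Q * x + adj (Q * x ^ (n - 1)))"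
    by (simp add: p_def cscale_diff_right cscale_add_right sum_subtractf sum.distrib scaleR_add_right)
  have "norm (\<Sum>j<n. cscale (cnj (w ^ j)) (\<psi> (p j))) \<le> norm (\<Sum>j<n. \<psi> (p j))"
    by (rule norm_unimodular_combination_le) (simp_all add: pos p w del: complex_cnj_power)
  then have "norm (\<psi> (\<Sum>j<n. cscale (cnj (w ^ j)) (p j))) \<le> norm (\<psi> (\<Sum>j<n. p j))"
    by (simp only: clinear_map_sum[OF lin] clinear_map_simps(2)[OF lin])
  then show ?thesis
    unfolding sum_wp sum_p using n0 by (simp only: clinear_map_simps(6)[OF lin] norm_scaleR) simp
qed

text \<open>On the open unit ball the bound is the limit of the Poisson averages, indexed by
  \<open>n + 2\<close> since these need at least two roots of unity. Other \<open>x\<close> are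
  scaled to norm \<open>z < 1\<close>, with \<open>z\<close> arbitrarily close to 1.\<close>

theorem positive_map_norm_le:
  fixes x :: "'a::cstar_algebra"
  assumes psi: "positive_map \<psi>"
  shows "norm (\<psi> x) \<le> norm (\<psi> 1) * norm x"
proof -
  have lin: "clinear_map \<psi>"
    using psi by (simp add: positive_map_def)
  have bl: "bounded_linear \<psi>"
    by (intro bounded_op_bounded_linear positive_map_bounded_op psi)
  have contr: "norm (\<psi> x) \<le> norm (\<psi> 1)" if x: "norm x < 1" for x
  proof -
    have small: "norm (x ^ (n + 2)) \<le> norm x" for n
    proof -
      have "norm (x ^ (n + 2)) \<le> norm x ^ (n + 2)"
        by (rule norm_power_ineq)
      also have "\<dots> \<le> norm x ^ 1"
        using x by (intro power_decreasing) simp_all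
      finally show ?thesis by simp
    qed
    then have "\<exists>b. inverse_pair (1 - x ^ (n + 2)) b" for n
      using x by (intro neumann_inverse) (metis le_less_trans)
    then obtain Q where Q: "\<And>n. inverse_pair (1 - x ^ (n + 2)) (Q n)"
      by metis
    have x0: "(\<lambda>n. x ^ (n + k)) \<longlonglongrightarrow> 0" for k
      by (rule LIMSEQ_ignore_initial_segment) (rule LIMSEQ_power_zero[OF x])
    have "(\<lambda>n. norm (x ^ (n + 2)) / (1 - norm (x ^ (n + 2)))) \<longlonglongrightarrow> norm (0 :: 'a) / (1 - norm (0 :: 'a))"
      by (intro tendsto_intros x0) simp
    then have "(\<lambda>n. norm (x ^ (n + 2)) / (1 - norm (x ^ (n + 2)))) \<longlonglongrightarrow> 0"
      by simp
    then have "(\<lambda>n. Q n - 1) \<longlonglongrightarrow> 0"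
    proof (rule Lim_null_comparison[rotated], intro always_eventually allI)
      show "norm (Q n - 1) \<le> norm (x ^ (n + 2)) / (1 - norm (x ^ (n + 2)))" for n
        by (rule norm_inverse_minus_one_le[OF Q]) (use small[of n] x in simp_all)
    qed
    then have Q1: "Q \<longlonglongrightarrow> 1"
      by (simp add: LIM_zero_iff)
    note lims = tendsto_norm bounded_linear.tendsto[OF bl] tendsto_add tendsto_diff
      bounded_linear.tendsto[OF bounded_linear_adj] tendsto_mult tendsto_const Q1 x0
    have "(\<lambda>n. norm (\<psi> (Q n * x + adj (Q n * x ^ (n + 1))))) \<longlonglongrightarrow> norm (\<psi> (1 * x + adj (1 * 0)))"
      by (intro lims)
    moreover have "(\<lambda>n. norm (\<psi> (Q n + adj (Q n) - 1))) \<longlonglongrightarrow> norm (\<psi> (1 + adj 1 - 1))"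
      by (intro lims)
    moreover have "norm (\<psi> (Q n * x + adj (Q n * x ^ (n + 1)))) \<le> norm (\<psi> (Q n + adj (Q n) - 1))" for n
      using positive_map_poisson_average[OF psi x _ Q, of n] by simp
    ultimately have "norm (\<psi> (1 * x + adj (1 * 0))) \<le> norm (\<psi> (1 + adj 1 - 1))"
      by (intro LIMSEQ_le) auto
    then show ?thesis
      by simp
  qed
  show ?thesis
  proof (cases "x = 0")
    case True
    then show ?thesis
      by (simp add: clinear_map_simps(3)[OF lin])
  next
    case False
    show ?thesis
    proof (rule field_le_mult_one_interval)
      fix z :: real assume z: "0 < z" "z < 1"
      have "norm (\<psi> ((z / norm x) *\<^sub>R x)) \<le> norm (\<psi> 1)"
        by (rule contr) (use False z in simp)
      then show "z * norm (\<psi> x) \<le> norm (\<psi> 1) * norm x"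
        using False z by (simp add: clinear_map_simps(6)[OF lin] pos_divide_le_eq)
    qed
  qed
qed

section \<open>The Banach algebra of bounded complex-linear operators\<close>

text \<open>Operators become elements of a Banach algebra, so that \<open>neumann_inverse\<close>
  and the results of \<open>central_scalars\<close> apply to them.\<close>

typedef (overloaded) ('a::cstar_algebra) cblinop =
  "{f :: 'a \<Rightarrow>\<^sub>L 'a. \<forall>c x. blinfun_apply f (cscale c x) = cscale c (blinfun_apply f x)}"
  morphisms blinfun_of_cblinop Abs_cblinop
  by (rule exI[of _ 0]) simp

setup_lifting type_definition_cblinop

instantiation cblinop :: (cstar_algebra) real_normed_algebra_1
begin

lift_definition norm_cblinop :: "'a cblinop \<Rightarrow> real" is norm .

lift_definition zero_cblinop :: "'a cblinop" is 0
  by simp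

lift_definition one_cblinop :: "'a cblinop" is id_blinfun
  by simp

lift_definition plus_cblinop :: "'a cblinop \<Rightarrow> 'a cblinop \<Rightarrow> 'a cblinop" is "(+)"
  by (simp add: blinfun.add_left cscale_add_right)

lift_definition minus_cblinop :: "'a cblinop \<Rightarrow> 'a cblinop \<Rightarrow> 'a cblinop" is "(-)"
  by (simp add: blinfun.diff_left cscale_diff_right)

lift_definition uminus_cblinop :: "'a cblinop \<Rightarrow> 'a cblinop" is uminus
  by (simp add: blinfun.minus_left cscale_minus_right)

lift_definition times_cblinop :: "'a cblinop \<Rightarrow> 'a cblinop \<Rightarrow> 'a cblinop" is blinfun_compose
  by simp

lift_definition scaleR_cblinop :: "real \<Rightarrow> 'a cblinop \<Rightarrow> 'a cblinop" is scaleR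
  by (simp add: blinfun.scaleR_left scaleR_cscale cscale_cscale mult.commute)

definition dist_cblinop :: "'a cblinop \<Rightarrow> 'a cblinop \<Rightarrow> real" where
  "dist_cblinop a b = norm (a - b)"

definition uniformity_cblinop :: "('a cblinop \<times> 'a cblinop) filter" where
  "uniformity_cblinop = (INF e\<in>{0 <..}. principal {(x, y). dist x y < e})"

definition open_cblinop :: "'a cblinop set \<Rightarrow> bool" where
  "open_cblinop S = (\<forall>x\<in>S. \<forall>\<^sub>F (x', y) in uniformity. x' = x \<longrightarrow> y \<in> S)"

definition sgn_cblinop :: "'a cblinop \<Rightarrow> 'a cblinop" where
  "sgn_cblinop x = scaleR (inverse (norm x)) x"

instance
proof
  fix a b c :: "'a cblinop" and r s :: real
  show "dist a b = norm (a - b)"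
    by (rule dist_cblinop_def)
  show "sgn a = inverse (norm a) *\<^sub>R a"
    by (rule sgn_cblinop_def)
  show "(uniformity :: ('a cblinop \<times> 'a cblinop) filter) = (INF e\<in>{0 <..}. principal {(x, y). dist x y < e})"
    by (rule uniformity_cblinop_def)
  show "open S = (\<forall>x\<in>S. \<forall>\<^sub>F (x', y) in uniformity. x' = x \<longrightarrow> y \<in> S)" for S :: "'a cblinop set"
    by (rule open_cblinop_def)
  show "a + b + c = a + (b + c)" "a + b = b + a" "0 + a = a" "- a + a = 0" "a - b = a + - b"
    by (transfer, simp add: algebra_simps)+
  show "r *\<^sub>R (a + b) = r *\<^sub>R a + r *\<^sub>R b" "(r + s) *\<^sub>R a = r *\<^sub>R a + s *\<^sub>R a"
    "r *\<^sub>R s *\<^sub>R a = (r * s) *\<^sub>R a" "1 *\<^sub>R a = a"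
    by (transfer, simp add: algebra_simps)+
  show "norm a = 0 \<longleftrightarrow> a = 0" "norm (r *\<^sub>R a) = \<bar>r\<bar> * norm a"
    by (transfer, simp)+
  show "norm (a + b) \<le> norm a + norm b"
    by transfer (rule norm_triangle_ineq)
  show "norm (a * b) \<le> norm a * norm b"
    by transfer (rule norm_blinfun_compose)
  show "norm (1 :: 'a cblinop) = 1"
    by transfer (rule norm_blinfun_id)
  show "(0 :: 'a cblinop) \<noteq> 1"
    by transfer (metis norm_blinfun_id norm_zero zero_neq_one)
  show "a * b * c = a * (b * c)" "1 * a = a" "a * 1 = a" "(a + b) * c = a * c + b * c"
    "a * (b + c) = a * b + a * c" "r *\<^sub>R a * b = r *\<^sub>R (a * b)" "a * r *\<^sub>R b = r *\<^sub>R (a * b)"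
    by (transfer, rule blinfun_eqI, simp add: blinfun.bilinear_simps)+
qed

end

lift_definition op_apply :: "'a::cstar_algebra cblinop \<Rightarrow> 'a \<Rightarrow> 'a" is blinfun_apply .

lemma cblinop_eqI: "(\<And>x. op_apply F x = op_apply G x) \<Longrightarrow> F = G"
  by transfer (rule blinfun_eqI)

lemma op_apply_simps [simp]:
  "op_apply 1 x = x" "op_apply (F + G) x = op_apply F x + op_apply G x"
  "op_apply (F - G) x = op_apply F x - op_apply G x" "op_apply (F * G) x = op_apply F (op_apply G x)"
  by (transfer, simp add: blinfun.bilinear_simps)+

lemma op_apply_cscale: "op_apply F (cscale c x) = cscale c (op_apply F x)"
  by transfer simp

lemma norm_cblinop_eq_onorm: "norm F = onorm (op_apply F)"
  by transfer (rule norm_blinfun.rep_eq)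

lemma norm_op_apply_le: "norm (op_apply F x) \<le> norm F * norm x"
  by transfer (rule norm_blinfun)

lemma bounded_op_op_apply: "bounded_op (op_apply F)"
proof -
  have "op_apply F (x + y) = op_apply F x + op_apply F y" for x y
    by transfer (rule blinfun.add_right)
  then show ?thesis
    unfolding bounded_op_def clinear_map_def using op_apply_cscale norm_op_apply_le by blast
qed

text \<open>Meaningful for bounded complex-linear \<open>f\<close>, where \<open>op_apply\<close>
  recovers \<open>f\<close>.\<close>

definition op_of :: "('a::cstar_algebra \<Rightarrow> 'a) \<Rightarrow> 'a cblinop" where
  "op_of f = Abs_cblinop (Blinfun f)"

lemma op_apply_op_of:
  assumes "bounded_op (f :: 'a::cstar_algebra \<Rightarrow> 'a)"
  shows "op_apply (op_of f) = f"
proof -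
  have "bounded_linear f"
    by (rule bounded_op_bounded_linear[OF assms])
  then have "blinfun_apply (Blinfun f) = f"
    by (rule bounded_linear_Blinfun_apply)
  moreover have "f (cscale c x) = cscale c (f x)" for c x
    using assms by (simp add: bounded_op_def clinear_map_def)
  ultimately show ?thesis
    by (simp add: op_apply_def op_of_def Abs_cblinop_inverse)
qed

text \<open>Complex linearity survives pointwise limits, so these operators form a closed subspace
  of the complete space of bounded real-linear ones.\<close>

instance cblinop :: (cstar_algebra) banach
proof
  fix X :: "nat \<Rightarrow> 'a cblinop"
  assume "Cauchy X"
  have dist: "dist (blinfun_of_cblinop F) (blinfun_of_cblinop G) = dist F G" for F G :: "'a cblinop"
    unfolding dist_norm by transfer simp
  have "Cauchy (\<lambda>n. blinfun_of_cblinop (X n))"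
    using \<open>Cauchy X\<close> by (simp add: Cauchy_def dist)
  then obtain L where L: "(\<lambda>n. blinfun_of_cblinop (X n)) \<longlonglongrightarrow> L"
    using Cauchy_convergent convergent_def by blast
  have lim: "(\<lambda>n. op_apply (X n) x) \<longlonglongrightarrow> blinfun_apply L x" for x
    unfolding op_apply.rep_eq by (intro blinfun.tendsto L tendsto_const)
  have "blinfun_apply L (cscale c x) = cscale c (blinfun_apply L x)" for c x
  proof (rule LIMSEQ_unique[OF lim])
    have "bounded_linear (cscale c :: 'a \<Rightarrow> 'a)"
      by (rule bounded_linear_intro[where K = "cmod c"])
        (simp_all add: cscale_add_right norm_cscale scaleR_cscale cscale_cscale mult.commute)
    then show "(\<lambda>n. op_apply (X n) (cscale c x)) \<longlonglongrightarrow> cscale c (blinfun_apply L x)"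
      unfolding op_apply_cscale using lim by (rule bounded_linear.tendsto)
  qed
  then have "blinfun_of_cblinop (Abs_cblinop L) = L"
    by (simp add: Abs_cblinop_inverse)
  then have "(\<lambda>n. dist (X n) (Abs_cblinop L)) \<longlonglongrightarrow> 0"
    using tendsto_dist_iff[THEN iffD1, OF L] by (simp add: dist[symmetric])
  then show "convergent X"
    unfolding convergent_def using tendsto_dist_iff by blast
qed

lemma bounded_op_cscale: "bounded_op (cscale c :: 'a::cstar_algebra \<Rightarrow> 'a)"
  unfolding bounded_op_def clinear_map_def
  by (intro conjI exI[of _ "cmod c"]) (auto simp: cscale_add_right cscale_cscale mult.commute norm_cscale)

interpretation op_scalar: central_scalars "\<lambda>c. op_of (cscale c :: 'a::cstar_algebra \<Rightarrow> 'a)"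
proof
  note [simp] = op_apply_op_of[OF bounded_op_cscale]
  fix c d :: complex and F :: "'a cblinop"
  show "op_of (cscale (c + d)) = op_of (cscale c :: 'a \<Rightarrow> 'a) + op_of (cscale d)"
    by (rule cblinop_eqI) (simp add: cscale_add_left)
  show mult: "op_of (cscale (c * d)) = op_of (cscale c :: 'a \<Rightarrow> 'a) * op_of (cscale d)" for c d
    by (rule cblinop_eqI) (simp add: cscale_cscale)
  show one: "op_of (cscale 1 :: 'a \<Rightarrow> 'a) = 1"
    by (rule cblinop_eqI) (simp add: cscale_one)
  show "F * op_of (cscale c) = op_of (cscale c) * F"
    by (rule cblinop_eqI) (simp add: op_apply_cscale)
  have le: "norm (op_of (cscale c) * F) \<le> cmod c * norm F" for c and F :: "'a cblinop"
  proof -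
    have "norm (op_of (cscale c :: 'a \<Rightarrow> 'a)) \<le> cmod c"
      unfolding norm_cblinop_eq_onorm by (rule onorm_bound) (simp_all add: norm_cscale)
    then show ?thesis
      by (meson mult_right_mono norm_ge_zero norm_mult_ineq order_trans)
  qed
  show "norm (op_of (cscale c) * F) = cmod c * norm F"
  proof (cases "c = 0")
    case True
    then show ?thesis
      using le[of 0 F] by simp
  next
    case False
    \<comment> \<open>The reverse inequality is \<open>le\<close> for the scalar
      \<open>1 / c\<close>.\<close>
    have "F = op_of (cscale (1 / c)) * (op_of (cscale c) * F)"
      using False by (simp add: mult.assoc[symmetric] mult[symmetric] one)
    then have "norm F \<le> cmod (1 / c) * norm (op_of (cscale c) * F)"
      by (metis le)
    then show ?thesis
      using False le[of c F] by (simp add: norm_divide field_simps)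
  qed
qed

section \<open>Spectrum and spectral radius of bounded operators\<close>

lemma not_in_op_spectrum_iff:
  assumes f: "bounded_op (f :: 'a::cstar_algebra \<Rightarrow> 'a)"
  shows "z \<notin> op_spectrum f \<longleftrightarrow> (\<exists>B. inverse_pair (op_of f - op_of (cscale z)) B)"
proof
  note [simp] = op_apply_op_of[OF bounded_op_cscale] op_apply_op_of[OF f]
  assume "z \<notin> op_spectrum f"
  then obtain g where g: "bounded_op g" "\<And>x. g (f x - cscale z x) = x" "\<And>x. f (g x) - cscale z (g x) = x"
    by (auto simp: op_spectrum_def)
  have "inverse_pair (op_of f - op_of (cscale z)) (op_of g)"
    unfolding inverse_pair_def by (intro conjI cblinop_eqI) (simp_all add: op_apply_op_of[OF g(1)] g)
  then show "\<exists>B. inverse_pair (op_of f - op_of (cscale z)) B" ..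
next
  note [simp] = op_apply_op_of[OF bounded_op_cscale] op_apply_op_of[OF f]
  assume "\<exists>B. inverse_pair (op_of f - op_of (cscale z)) B"
  then obtain B where B: "(op_of f - op_of (cscale z)) * B = 1" "B * (op_of f - op_of (cscale z)) = 1"
    by (auto simp: inverse_pair_def)
  have "f (op_apply B x) - cscale z (op_apply B x) = x" "op_apply B (f x - cscale z x) = x" for x
    using arg_cong[OF B(1), of "\<lambda>F. op_apply F x"] arg_cong[OF B(2), of "\<lambda>F. op_apply F x"] by simp_all
  then show "z \<notin> op_spectrum f"
    unfolding op_spectrum_def using bounded_op_op_apply[of B] by blast
qed

lemma inverse_pair_op_scalar:
  assumes "inverse_pair A B" "c \<noteq> 0"
  shows "inverse_pair (op_of (cscale c) * A) (op_of (cscale (1 / c)) * (B :: 'a::cstar_algebra cblinop))"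
proof -
  have "inverse_pair (op_of (cscale c :: 'a \<Rightarrow> 'a)) (op_of (cscale (1 / c)))"
    using assms(2) by (simp add: inverse_pair_def op_scalar.iota_mult[symmetric])
  then have "inverse_pair (op_of (cscale c) * A) (B * op_of (cscale (1 / c)))"
    using assms(1) by (rule inverse_pair_mult)
  then show ?thesis
    by (simp only: op_scalar.iota_central)
qed

lemma op_spectrum_cmod_le:
  assumes f: "bounded_op (f :: 'a::cstar_algebra \<Rightarrow> 'a)" and z: "z \<in> op_spectrum f"
  shows "cmod z \<le> onorm f"
proof (rule ccontr)
  assume less: "\<not> cmod z \<le> onorm f"
  have norm_f: "norm (op_of f) = onorm f"
    by (simp add: norm_cblinop_eq_onorm op_apply_op_of[OF f])
  then have z0: "z \<noteq> 0"
    using less norm_ge_zero[of "op_of f"] by auto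
  have "norm (op_of (cscale (1 / z)) * op_of f) < 1"
    using less z0 by (simp add: op_scalar.norm_iota_mult norm_f norm_divide divide_simps)
  then obtain B where "inverse_pair (1 - op_of (cscale (1 / z)) * op_of f) B"
    using neumann_inverse by blast
  from inverse_pair_op_scalar[OF this, of "- z"] z0
  obtain C where "inverse_pair (op_of (cscale (- z)) * (1 - op_of (cscale (1 / z)) * op_of f)) C"
    by auto
  moreover have "op_of (cscale (- z)) * (1 - op_of (cscale (1 / z)) * op_of f) = op_of f - op_of (cscale z)"
    by (rule cblinop_eqI)
      (use z0 in \<open>simp add: op_apply_op_of[OF bounded_op_cscale] cscale_minus_left cscale_diff_right
        cscale_cscale cscale_one\<close>)
  ultimately show False
    using z not_in_op_spectrum_iff[OF f] by metis
qed

text \<open>This replaces the appeal to Liouville's theorem. With empty spectrum,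
  \<open>1 - \<mu> F\<close> is invertible for all \<open>\<mu>\<close>, so
  \<open>norm (F ^ n) * u ^ n\<close> tends to 0 for every \<open>u >= 0\<close>. Since 0 is not a
  spectral value either, \<open>F\<close> has an inverse \<open>H\<close>, and
  \<open>u = norm H\<close> contradicts \<open>F ^ n * H ^ n = 1\<close>.\<close>

lemma op_spectrum_nonempty:
  assumes f: "bounded_op (f :: 'a::cstar_algebra \<Rightarrow> 'a)"
  shows "op_spectrum f \<noteq> {}"
proof
  assume empty: "op_spectrum f = {}"
  define F where "F = op_of f"
  have inv: "\<exists>B. inverse_pair (F - op_of (cscale z)) B" for z
    using not_in_op_spectrum_iff[OF f, of z] empty by (simp add: F_def)
  have "\<exists>B. inverse_pair (1 - op_of (cscale \<mu>) * F) B" for \<mu>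
  proof (cases "\<mu> = 0")
    case True
    then show ?thesis
      by (auto simp: inverse_pair_def intro: exI[of _ 1])
  next
    case False
    obtain B where "inverse_pair (F - op_of (cscale (1 / \<mu>))) B"
      using inv by blast
    from inverse_pair_op_scalar[OF this, of "- \<mu>"] False
    obtain C where "inverse_pair (op_of (cscale (- \<mu>)) * (F - op_of (cscale (1 / \<mu>)))) C"
      by auto
    moreover have "op_of (cscale (- \<mu>)) * (F - op_of (cscale (1 / \<mu>))) = 1 - op_of (cscale \<mu>) * F"
      by (rule cblinop_eqI)
        (use False in \<open>simp add: op_apply_op_of[OF bounded_op_cscale] cscale_minus_left cscale_diff_right
          cscale_cscale cscale_one\<close>)
    ultimately show ?thesis
      by auto
  qed
  then obtain G where G: "\<And>\<mu>. inverse_pair (1 - op_of (cscale \<mu>) * F) (G \<mu>)"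
    by metis
  obtain H where H: "inverse_pair F H"
    using inv[of 0] by auto
  have "(\<lambda>n. norm (F ^ n) * norm H ^ n) \<longlonglongrightarrow> 0"
    by (rule op_scalar.powers_tendsto_zero_of_resolvent[OF G, where m = "norm H + 1"]) simp_all
  then have "eventually (\<lambda>n. norm (F ^ n) * norm H ^ n < 1) sequentially"
    by (rule order_tendstoD(2)) simp
  then obtain n where n: "norm (F ^ n) * norm H ^ n < 1"
    by (auto simp: eventually_sequentially)
  have "F ^ k * H ^ k = 1" for k
  proof (induction k)
    case (Suc k)
    have "F ^ Suc k * H ^ Suc k = F * (F ^ k * H ^ k) * H"
      by (simp add: mult.assoc power_commutes)
    then show ?case
      using Suc H by (simp add: inverse_pair_def)
  qed simp
  then have "1 = norm (F ^ n * H ^ n)"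
    by simp
  also have "\<dots> \<le> norm (F ^ n) * norm (H ^ n)"
    by (rule norm_mult_ineq)
  also have "\<dots> \<le> norm (F ^ n) * norm H ^ n"
    by (intro mult_left_mono norm_power_ineq) simp
  finally show False
    using n by simp
qed

lemma op_spectrum_conjugate:
  fixes f a b :: "'a::cstar_algebra \<Rightarrow> 'a"
  assumes f: "bounded_op f" and a: "bounded_op a" and b: "bounded_op b"
    and ab: "\<And>x. a (b x) = x" "\<And>x. b (a x) = x" and g: "bounded_op (b \<circ> f \<circ> a)"
  shows "op_spectrum (b \<circ> f \<circ> a) \<subseteq> op_spectrum f"
proof
  fix z assume z: "z \<in> op_spectrum (b \<circ> f \<circ> a)"
  note [simp] = op_apply_op_of[OF bounded_op_cscale] op_apply_op_of[OF f] op_apply_op_of[OF a]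
    op_apply_op_of[OF b] op_apply_op_of[OF g]
  show "z \<in> op_spectrum f"
  proof (rule ccontr)
    assume "z \<notin> op_spectrum f"
    then obtain B where B: "inverse_pair (op_of f - op_of (cscale z)) B"
      by (auto simp: not_in_op_spectrum_iff[OF f])
    have ba: "inverse_pair (op_of b) (op_of a)"
      unfolding inverse_pair_def by (intro conjI cblinop_eqI) (simp_all add: ab)
    have "b (x - y) = b x - b y" for x y
      using b by (simp add: bounded_op_def clinear_map_simps(5))
    moreover have "b (cscale z x) = cscale z (b x)" for x
      using b by (simp add: bounded_op_def clinear_map_def)
    ultimately have "op_of b * ((op_of f - op_of (cscale z)) * op_of a) = op_of (b \<circ> f \<circ> a) - op_of (cscale z)"
      by (intro cblinop_eqI) (simp add: ab)
    then have "\<exists>B. inverse_pair (op_of (b \<circ> f \<circ> a) - op_of (cscale z)) B"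
      using inverse_pair_mult[OF ba inverse_pair_mult[OF B inverse_pair_sym[OF ba]]] by metis
    then show False
      using z not_in_op_spectrum_iff[OF g] by blast
  qed
qed

lemma op_spectral_radius_nonneg:
  assumes "bounded_op (f :: 'a::cstar_algebra \<Rightarrow> 'a)"
  shows "0 \<le> op_spectral_radius f"
proof -
  obtain z where "z \<in> op_spectrum f"
    using op_spectrum_nonempty[OF assms] by blast
  moreover have "bdd_above (cmod ` op_spectrum f)"
    using op_spectrum_cmod_le[OF assms] by (intro bdd_aboveI2)
  ultimately have "cmod z \<le> op_spectral_radius f"
    unfolding op_spectral_radius_def by (intro cSup_upper) auto
  then show ?thesis
    using norm_ge_zero order_trans by blast
qed

section \<open>Elementary similarity\<close>

lemma positive_map_alpha: "positive_map (alpha a :: 'a::cstar_algebra \<Rightarrow> 'a)"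
  by (simp add: positive_map_def clinear_map_def alpha_def positive_el_conj distrib_left distrib_right
      cscale_mult_left cscale_mult_right)

lemma positive_map_comp:
  "positive_map f \<Longrightarrow> positive_map g \<Longrightarrow> positive_map (f \<circ> g :: 'a::cstar_algebra \<Rightarrow> 'a)"
  by (simp add: positive_map_def clinear_map_def)

text \<open>In this form \<open>alpha_inv\<close> inherits positivity and boundedness from
  \<open>alpha\<close>.\<close>

lemma alpha_inv_eq_alpha:
  assumes "inverse_pair a (b :: 'a::cstar_algebra)"
  shows "alpha_inv a = alpha b"
  by (simp add: fun_eq_iff alpha_inv_def alpha_def inv_el_eq[OF assms] inv_el_eq[OF inverse_pair_adj[OF assms]])

lemma alpha_alpha:
  assumes "inverse_pair a (b :: 'a::cstar_algebra)"
  shows "alpha a (alpha b x) = x" "alpha b (alpha a x) = x"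
proof -
  have "alpha c (alpha d x) = adj (d * c) * x * (d * c)" for c d
    by (simp add: alpha_def adj_mult mult.assoc)
  then show "alpha a (alpha b x) = x" "alpha b (alpha a x) = x"
    using assms by (simp_all add: inverse_pair_def)
qed

text \<open>Conjugating back shows that each spectral value of \<open>\<phi>\<close> is one of the
  conjugated map, hence at most its norm.\<close>

lemma op_spectral_radius_le_onorm_conjugate:
  assumes phi: "positive_map (\<phi> :: 'a::cstar_algebra \<Rightarrow> 'a)" and ab: "inverse_pair a b"
  shows "op_spectral_radius \<phi> \<le> onorm (alpha b \<circ> \<phi> \<circ> alpha a)"
proof -
  let ?\<psi> = "alpha b \<circ> \<phi> \<circ> alpha a"
  have psi: "positive_map ?\<psi>"
    by (intro positive_map_comp positive_map_alpha phi)
  have eq: "alpha a \<circ> ?\<psi> \<circ> alpha b = \<phi>"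
    by (simp add: fun_eq_iff alpha_alpha[OF ab])
  have "op_spectrum (alpha a \<circ> ?\<psi> \<circ> alpha b) \<subseteq> op_spectrum ?\<psi>"
    by (rule op_spectrum_conjugate)
      (simp_all only: alpha_alpha[OF ab] eq positive_map_bounded_op psi phi positive_map_alpha)
  then have "op_spectrum \<phi> \<subseteq> op_spectrum ?\<psi>"
    by (simp only: eq)
  then have "cmod z \<le> onorm ?\<psi>" if "z \<in> op_spectrum \<phi>" for z
    using that op_spectrum_cmod_le[OF positive_map_bounded_op[OF psi]] by blast
  then show ?thesis
    unfolding op_spectral_radius_def
    using op_spectrum_nonempty[OF positive_map_bounded_op[OF phi]] by (intro cSup_least) auto
qed

section \<open>The cycle of implications: (2) to (3), (3) to (1), (1) to (2)\<close>

lemma invertible_el_sqrt: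
  assumes "invertible_el (k * k :: 'a::cstar_algebra)"
  shows "invertible_el k"
  using assms inverse_pair_of_commuting_product[of k k] unfolding invertible_el_iff by blast

lemma onorm_eq_of_subinvariant:
  fixes \<phi> :: "'a::cstar_algebra \<Rightarrow> 'a"
  assumes phi: "positive_map \<phi>" and r: "r = op_spectral_radius \<phi>"
    and w: "strictly_positive w" "cle (\<phi> w) (cscale (complex_of_real r) w)"
  shows "\<exists>v. strictly_positive v \<and> onorm (alpha_inv v \<circ> \<phi> \<circ> alpha v) = r"
proof -
  obtain v where v: "positive_el v" "v * v = w"
    using w(1) positive_el_sqrt unfolding strictly_positive_def by blast
  have inv_v: "invertible_el v"
    using w(1) v(2) invertible_el_sqrt[of v] by (simp add: strictly_positive_def)
  then obtain b where vb: "inverse_pair v b"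
    by (auto simp: invertible_el_iff)
  let ?\<psi> = "alpha b \<circ> \<phi> \<circ> alpha v"
  have psi: "positive_map ?\<psi>"
    by (intro positive_map_comp positive_map_alpha phi)
  have alpha_v: "alpha v 1 = w"
    by (simp add: alpha_def positive_el_adj[OF v(1)] v(2))
  have "positive_el (alpha b (cscale (complex_of_real r) w - \<phi> w))"
    using w(2) positive_map_alpha[of b] by (simp add: cle_def positive_map_def)
  \<comment> \<open>As \<open>alpha v 1 = w\<close>, applying \<open>alpha b\<close> sends
    \<open>w\<close> to 1 and \<open>\<phi> w\<close> to \<open>?\<psi> 1\<close>.\<close>
  moreover have "alpha b (cscale (complex_of_real r) w - \<phi> w) = of_real r - ?\<psi> 1"
  proof -
    have lin: "clinear_map (alpha b)"
      using positive_map_alpha[of b] by (simp add: positive_map_def)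
    have "alpha b w = 1"
      using alpha_alpha(2)[OF vb, of 1] by (simp add: alpha_v)
    then show ?thesis
      by (simp add: clinear_map_simps[OF lin] alpha_v cscale_of_real_one)
  qed
  ultimately have "positive_el (of_real r - ?\<psi> 1)"
    by simp
  moreover have "positive_el (?\<psi> 1)"
    using psi by (rule positive_map_one)
  ultimately have "norm (?\<psi> 1) \<le> norm (of_real r :: 'a)"
    by (intro norm_mono_positive)
  \<comment> \<open>The norm of \<open>of_real r\<close> is the absolute value of \<open>r\<close>;
    it equals \<open>r\<close> because the spectral radius is nonnegative.\<close>
  then have "norm (?\<psi> 1) \<le> r"
    using op_spectral_radius_nonneg[OF positive_map_bounded_op[OF phi]] r by simp
  moreover have "onorm ?\<psi> \<le> norm (?\<psi> 1)"
    by (rule onorm_bound) (simp_all only: norm_ge_zero positive_map_norm_le[OF psi])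
  ultimately have "onorm ?\<psi> = r"
    using op_spectral_radius_le_onorm_conjugate[OF phi vb] r by linarith
  then show ?thesis
    using v(1) inv_v alpha_inv_eq_alpha[OF vb] by (auto simp: strictly_positive_def)
qed

text \<open>The witness for the similarity is the inverse \<open>b\<close> of \<open>v\<close>,
  since \<open>elem_similar\<close> asks for the conjugation leading back to
  \<open>\<phi>\<close>.\<close>

lemma elem_similar_of_strictly_positive:
  assumes phi: "positive_map (\<phi> :: 'a::cstar_algebra \<Rightarrow> 'a)" and v: "strictly_positive v"
  shows "positive_map (alpha_inv v \<circ> \<phi> \<circ> alpha v)" "elem_similar (alpha_inv v \<circ> \<phi> \<circ> alpha v) \<phi>"
proof -
  obtain b where vb: "inverse_pair v b"
    using v by (auto simp: strictly_positive_def invertible_el_iff)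
  show "positive_map (alpha_inv v \<circ> \<phi> \<circ> alpha v)"
    unfolding alpha_inv_eq_alpha[OF vb] by (intro positive_map_comp positive_map_alpha phi)
  have "\<phi> = alpha_inv b \<circ> (alpha_inv v \<circ> \<phi> \<circ> alpha v) \<circ> alpha b"
    unfolding alpha_inv_eq_alpha[OF vb] alpha_inv_eq_alpha[OF inverse_pair_sym[OF vb]]
    by (simp add: fun_eq_iff alpha_alpha[OF vb])
  then show "elem_similar (alpha_inv v \<circ> \<phi> \<circ> alpha v) \<phi>"
    unfolding elem_similar_def invertible_el_iff using inverse_pair_sym[OF vb] by blast
qed

lemma subinvariant_of_elem_similar:
  assumes psi: "positive_map (\<psi> :: 'a::cstar_algebra \<Rightarrow> 'a)" and sim: "elem_similar \<psi> \<phi>"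
    and r: "onorm \<psi> = r"
  shows "\<exists>w. strictly_positive w \<and> cle (\<phi> w) (cscale (complex_of_real r) w)"
proof -
  obtain a b where ab: "inverse_pair a b" and phi: "\<phi> = alpha b \<circ> \<psi> \<circ> alpha a"
    using sim alpha_inv_eq_alpha unfolding elem_similar_def invertible_el_iff by metis
  \<comment> \<open>This is \<open>adj b * b\<close>, and \<open>alpha a\<close> sends it to 1, so
    \<open>\<phi> w = alpha b (\<psi> 1)\<close>.\<close>
  define w where "w = alpha b 1"
  have "positive_el w"
    by (simp add: w_def alpha_def positive_el_adj_mult)
  moreover have "invertible_el w"
    unfolding invertible_el_iff w_def alpha_def
    using inverse_pair_mult[OF inverse_pair_adj inverse_pair_sym, OF inverse_pair_sym[OF ab] ab] by auto
  moreover have "cle (\<phi> w) (cscale (complex_of_real r) w)"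
  proof -
    have lin: "clinear_map (alpha b)"
      using positive_map_alpha[of b] by (simp add: positive_map_def)
    have "norm (\<psi> 1) \<le> r"
      using onorm[OF bounded_op_bounded_linear[OF positive_map_bounded_op[OF psi]], of 1] r by simp
    moreover have "adj (\<psi> 1) = \<psi> 1"
      by (intro positive_el_adj positive_map_one psi)
    ultimately have "positive_el (of_real r - \<psi> 1)"
      by (intro positive_el_norm_minus)
    then have "positive_el (alpha b (of_real r - \<psi> 1))"
      using positive_map_alpha[of b] by (simp add: positive_map_def)
    moreover have "alpha b (of_real r - \<psi> 1) = cscale (complex_of_real r) w - \<phi> w"
      by (simp add: phi w_def alpha_alpha[OF ab] clinear_map_simps[OF lin] cscale_of_real_one[symmetric])
    ultimately show ?thesis
      by (simp add: cle_def)
  qed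
  ultimately show ?thesis
    by (auto simp: strictly_positive_def)
qed

theorem theorem3p5:
  fixes \<phi> :: "'a::cstar_algebra \<Rightarrow> 'a" and r :: real
  assumes "positive_map \<phi>"
    and "r = op_spectral_radius \<phi>"
  shows "((\<exists>\<psi>. positive_map \<psi> \<and> elem_similar \<psi> \<phi> \<and> onorm \<psi> = r)
           \<longleftrightarrow> (\<exists>w. strictly_positive w \<and> cle (\<phi> w) (cscale (complex_of_real r) w)))
       \<and> ((\<exists>w. strictly_positive w \<and> cle (\<phi> w) (cscale (complex_of_real r) w))
           \<longleftrightarrow> (\<exists>v. strictly_positive v \<and> onorm (alpha_inv v \<circ> \<phi> \<circ> alpha v) = r))"
  using onorm_eq_of_subinvariant[OF assms] elem_similar_of_strictly_positive[OF assms(1)]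
    subinvariant_of_elem_similar[of _ \<phi> r]
  by metis

end
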